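(* Let $G$ be a finite abelian group, let $\mathbb{Q}(\widetilde G)$ be its (contracted) generalized character algebra for the chain $1\subset G$, let $J$ be the Jacobson radical of $\mathbb{Q}(\widetilde G)$ and let $I$ be the ideal of $\mathbb{Q}(\widetilde G)$ generated by the elements $\chi_{gH}-\chi_A$, where $A$ runs over the nonempty subsets of $G$, $H=n(A)$ and $g\in G$ is such that $A\subset gH$. Then $J=I$, and there is a ring isomorphism $$\varphi:\bigoplus_{H<G}\mathbb{Q}(G/H)\to\mathbb{Q}(\widetilde G)/J,$$ the sum running over the proper subgroups $H$ of $G$, which sends the unit element $e_H$ of the group algebra $\mathbb{Q}(G/H)$ to (the class of) $\prod_{\overline{H'}\in\mathcal{M}(G/H)}(\chi_H-\chi_{H'})$.
   Context: Let $S$ be the semigroup of nonempty subsets of $G$ with product $AB=\{ab:a\in A,b\in B\}$. The generalized character ring of the chain $1\subset G$, modulo the ideal $\mathbb{Z}\chi_\emptyset$ generated by the character of the glider $\mathbb{C}\supset0\supset\cdots$, is the semigroup ring $\mathbb{Z}S$: it has $\mathbb{Z}$-basis $\chi_A$ ($\emptyset\ne A\subset G$) with $\chi_A\chi_B=\chi_{AB}$ and unit $\chi_{\{1\}}$. The element $\theta=\chi_G$ is a zero element of the semigroup, and $\mathbb{Q}(\widetilde G)$ here denotes the contracted semigroup algebra over $\mathbb{Q}$, i.e. $\mathbb{Q}S/\mathbb{Q}\chi_G$ (so $\chi_G=0$). For a nonempty $A\subset G$, $n(A)$ denotes the unique idempotent in the cyclic semigroup $\{A^k:k\ge1\}\subset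 S$; it is a subgroup of $G$, and there always exists $g\in G$ with $A\subset g\,n(A)$. $\mathcal{M}(G/H)$ is the set of minimal nontrivial (normal) subgroups of $G/H$; for $\overline{H'}\in\mathcal{M}(G/H)$, $H'$ is the subgroup of $G$ containing $H$ with $H'/H=\overline{H'}$. *)

theory Defs
  imports "HOL-Algebra.Algebra"
begin

section \<open>Monoid algebras and finite products of rings\<close>

text \<open>
  The elements of the algebra \<open>k[M]\<close> are the finitely supported functions \<open>'m \<Rightarrow> 'k\<close> vanishing
  off \<open>carrier M\<close>; the coefficient ring is the whole type \<open>'k\<close>.
\<close>

definition monoid_algebra :: "('m, 'n) monoid_scheme \<Rightarrow> ('m \<Rightarrow> 'k::comm_ring_1) ring" where
  "monoid_algebra M =
     \<lparr>carrier = {f. finite {x. f x \<noteq> 0} \<and> {x. f x \<noteq> 0} \<subseteq> carrier M},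
      monoid.mult = (\<lambda>f g x. \<Sum>(a, b) \<in> {(a, b). f a \<noteq> 0 \<and> g b \<noteq> 0 \<and> a \<otimes>\<^bsub>M\<^esub> b = x}. f a * g b),
      monoid.one = (\<lambda>x. if x = \<one>\<^bsub>M\<^esub> then 1 else 0),
      ring.zero = (\<lambda>x. 0),
      ring.add = (\<lambda>f g x. f x + g x)\<rparr>"

definition basis_elem :: "'m \<Rightarrow> 'm \<Rightarrow> 'k::comm_ring_1" where
  "basis_elem x = (\<lambda>y. if y = x then 1 else 0)"

text \<open>For a finite index set, which is the only case used, this is the direct sum of the rings.\<close>

definition product_ring :: "'i set \<Rightarrow> ('i \<Rightarrow> ('b, 'c) ring_scheme) \<Rightarrow> ('i \<Rightarrow> 'b) ring" where
  "product_ring I R =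
     \<lparr>carrier = (\<Pi>\<^sub>E i\<in>I. carrier (R i)),
      monoid.mult = (\<lambda>x y. \<lambda>i\<in>I. x i \<otimes>\<^bsub>R i\<^esub> y i),
      monoid.one = (\<lambda>i\<in>I. \<one>\<^bsub>R i\<^esub>),
      ring.zero = (\<lambda>i\<in>I. \<zero>\<^bsub>R i\<^esub>),
      ring.add = (\<lambda>x y. \<lambda>i\<in>I. x i \<oplus>\<^bsub>R i\<^esub> y i)\<rparr>"

definition summand_inj ::
    "'i set \<Rightarrow> ('i \<Rightarrow> ('b, 'c) ring_scheme) \<Rightarrow> 'i \<Rightarrow> 'b \<Rightarrow> ('i \<Rightarrow> 'b)" where
  "summand_inj I R i x = (\<lambda>j\<in>I. if j = i then x else \<zero>\<^bsub>R j\<^esub>)"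

text \<open>
  Meant for commutative rings, where the one-sided maximal ideals are the maximal ideals.
  Intersecting with the carrier makes the radical of the zero ring, which has no maximal ideal,
  the whole ring.
\<close>

definition jacobson_radical :: "('b, 'c) ring_scheme \<Rightarrow> 'b set" where
  "jacobson_radical R = carrier R \<inter> \<Inter>{M. maximalideal M R}"


section \<open>The contracted generalized character algebra\<close>

definition subset_monoid :: "('a, 'b) monoid_scheme \<Rightarrow> 'a set monoid" where
  "subset_monoid G =
     \<lparr>carrier = {A. A \<subseteq> carrier G \<and> A \<noteq> {}},
      monoid.mult = (\<lambda>A B. A <#>\<^bsub>G\<^esub> B),
      monoid.one = {\<one>\<^bsub>G\<^esub>}\<rparr>"

text \<open>
  \<open>carrier G\<close> is a zero element of \<open>subset_monoid G\<close> when \<open>G\<close> is a group, so the line it spans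
  is an ideal of the monoid algebra.
\<close>

definition zero_line :: "('a, 'b) monoid_scheme \<Rightarrow> ('a set \<Rightarrow> rat) set" where
  "zero_line G = {(\<lambda>B. c * basis_elem (carrier G) B) | c. True}"

definition char_algebra :: "('a, 'b) monoid_scheme \<Rightarrow> ('a set \<Rightarrow> rat) set ring" where
  "char_algebra G = monoid_algebra (subset_monoid G) Quot zero_line G"

definition chi :: "('a, 'b) monoid_scheme \<Rightarrow> 'a set \<Rightarrow> ('a set \<Rightarrow> rat) set" where
  "chi G A = zero_line G +>\<^bsub>monoid_algebra (subset_monoid G)\<^esub> basis_elem A"

text \<open>The subgroup \<open>n(A)\<close>: the unique idempotent among the powers \<open>A\<^sup>k\<close> with \<open>k \<ge> 1\<close>.\<close>

definition idem_power :: "('a, 'b) monoid_scheme \<Rightarrow> 'a set \<Rightarrow> 'a set" where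
  "idem_power G A =
     (THE B. B \<in> {A [^]\<^bsub>subset_monoid G\<^esub> k | k::nat. k \<ge> 1} \<and> B <#>\<^bsub>G\<^esub> B = B)"

definition coset_ideal :: "('a, 'b) monoid_scheme \<Rightarrow> ('a set \<Rightarrow> rat) set set" where
  "coset_ideal G =
     Idl\<^bsub>char_algebra G\<^esub>
       {chi G (g <#\<^bsub>G\<^esub> idem_power G A) \<ominus>\<^bsub>char_algebra G\<^esub> chi G A | A g.
          A \<subseteq> carrier G \<and> A \<noteq> {} \<and> g \<in> carrier G \<and> A \<subseteq> g <#\<^bsub>G\<^esub> idem_power G A}"


section \<open>Subgroups\<close>

definition proper_subgroups :: "('a, 'b) monoid_scheme \<Rightarrow> 'a set set" where
  "proper_subgroups G = {H. subgroup H G \<and> H \<noteq> carrier G}"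

definition min_nontrivial_subgroups :: "('a, 'b) monoid_scheme \<Rightarrow> 'a set set" where
  "min_nontrivial_subgroups G =
     {K. subgroup K G \<and> K \<noteq> {\<one>\<^bsub>G\<^esub>} \<and>
         (\<forall>L. subgroup L G \<and> L \<subseteq> K \<and> L \<noteq> {\<one>\<^bsub>G\<^esub>} \<longrightarrow> L = K)}"

text \<open>The subgroup \<open>H' \<supseteq> H\<close> of \<open>G\<close> with \<open>H'/H = K\<close>, for a subgroup \<open>K\<close> of \<open>G Mod H\<close>.\<close>

definition quotient_preimage :: "('a, 'b) monoid_scheme \<Rightarrow> 'a set \<Rightarrow> 'a set set \<Rightarrow> 'a set" where
  "quotient_preimage G H K = {x \<in> carrier G. H #>\<^bsub>G\<^esub> x \<in> K}"

definition quotient_group_algebra ::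
    "('a, 'b) monoid_scheme \<Rightarrow> 'a set \<Rightarrow> ('a set \<Rightarrow> rat) ring" where
  "quotient_group_algebra G H = monoid_algebra (G Mod H)"

end

theory Submission
  imports Defs "HOL-Library.Function_Algebras"
begin

text \<open>
  For a proper subgroup \<open>H\<close>, send \<open>\<chi>\<^sub>A\<close> to the coset of \<open>H\<close> containing \<open>A\<close> if there is one and to \<open>0\<close>
  otherwise. Since \<open>AB\<close> lies in a single coset iff both \<open>A\<close> and \<open>B\<close> do, this is a ring homomorphism
  to \<open>\<rat>(G/H)\<close>, and it kills \<open>\<chi>\<^sub>G\<close>. Taken together these maps are surjective onto the product of the
  \<open>\<rat>(G/H)\<close>, because on cosets ordered by inclusion they are triangular. Their common kernel is \<open>I\<close>:
  \<open>A\<close> and \<open>g n(A)\<close> lie in the same cosets, and modulo \<open>I\<close> only cosets are left.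
  A generator \<open>\<chi>\<^sub>g\<^sub>H - \<chi>\<^sub>A = \<chi>\<^sub>A (\<chi>\<^sub>H - 1)\<close> is nilpotent because a power of \<open>\<chi>\<^sub>A\<close> is the idempotent \<open>\<chi>\<^sub>H\<close>;
  hence \<open>I \<subseteq> J\<close>. Conversely, the powers \<open>f\<^sup>n R\<close> stabilise in a finite-dimensional algebra, so the
  elements of \<open>J\<close> are nilpotent, and they die in the reduced rings \<open>\<rat>(G/H)\<close>. Finally the \<open>L\<close>-component
  of the product of the \<open>\<chi>\<^sub>H - \<chi>\<^sub>H\<^sub>'\<close> is \<open>1\<close> for \<open>L = H\<close>, and vanishes if \<open>H \<subset> L\<close> (some \<open>H' \<subseteq> L\<close>) or
  if \<open>H\<close> is not contained in \<open>L\<close>.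
\<close>

section \<open>Algebras of finite commutative monoids\<close>

lemma carrier_monoid_algebra:
  assumes "finite (carrier M)"
  shows "f \<in> carrier (monoid_algebra M) \<longleftrightarrow> (\<forall>x. x \<notin> carrier M \<longrightarrow> f x = 0)"
  using assms by (auto simp: monoid_algebra_def intro: finite_subset[rotated])

lemma monoid_algebra_simps:
  "\<zero>\<^bsub>monoid_algebra M\<^esub> = (\<lambda>x. 0)"
  "\<one>\<^bsub>monoid_algebra M\<^esub> = basis_elem \<one>\<^bsub>M\<^esub>"
  "f \<oplus>\<^bsub>monoid_algebra M\<^esub> g = (\<lambda>x. f x + g x)"
  by (auto simp: monoid_algebra_def basis_elem_def)

lemma basis_elem_closed:
  "x \<in> carrier M \<Longrightarrow> (basis_elem x :: _ \<Rightarrow> 'k::comm_ring_1) \<in> carrier (monoid_algebra M)"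
  by (auto simp: monoid_algebra_def basis_elem_def)

text \<open>Pairs outside the supports, or with a different product, contribute zero. The index set
  that depends on \<open>f\<close> and \<open>g\<close> thus becomes the whole carrier, over which
  sums can be swapped and distributed freely.\<close>

lemma monoid_algebra_mult_apply:
  assumes fin: "finite (carrier M)"
    and f: "f \<in> carrier (monoid_algebra M)" and g: "g \<in> carrier (monoid_algebra M)"
  shows "(f \<otimes>\<^bsub>monoid_algebra M\<^esub> g) x =
    (\<Sum>a\<in>carrier M. \<Sum>b\<in>carrier M. f a * g b * of_bool (a \<otimes>\<^bsub>M\<^esub> b = x))"
proof -
  have "(f \<otimes>\<^bsub>monoid_algebra M\<^esub> g) x =
      (\<Sum>(a, b) \<in> {(a, b). f a \<noteq> 0 \<and> g b \<noteq> 0 \<and> a \<otimes>\<^bsub>M\<^esub> b = x}. f a * g b)"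
    by (simp add: monoid_algebra_def)
  also have "\<dots> = (\<Sum>(a, b)\<in>carrier M \<times> carrier M. f a * g b * of_bool (a \<otimes>\<^bsub>M\<^esub> b = x))"
    using f g fin
    by (intro sum.mono_neutral_cong_left) (auto simp: carrier_monoid_algebra of_bool_def split: if_splits)
  finally show ?thesis
    by (simp add: sum.cartesian_product)
qed

text \<open>Products are determined by their pairings with arbitrary weights \<open>u\<close>; all ring laws and
  homomorphism laws below are read off from this formula.\<close>

lemma (in monoid) monoid_algebra_mult_pairing:
  assumes fin: "finite (carrier G)"
    and f: "f \<in> carrier (monoid_algebra G)" and g: "g \<in> carrier (monoid_algebra G)"
  shows "(\<Sum>x\<in>carrier G. (f \<otimes>\<^bsub>monoid_algebra G\<^esub> g) x * u x) =
    (\<Sum>a\<in>carrier G. \<Sum>b\<in>carrier G. f a * g b * u (a \<otimes> b))"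
proof -
  have single: "(\<Sum>x\<in>carrier G. of_bool (y = x) * u x) = u y" if "y \<in> carrier G" for y
  proof -
    have "(\<Sum>x\<in>carrier G. of_bool (y = x) * u x) = (\<Sum>x\<in>carrier G. if x = y then u x else 0)"
      by (intro sum.cong) auto
    then show ?thesis
      using fin that by simp
  qed
  have "(\<Sum>x\<in>carrier G. (f \<otimes>\<^bsub>monoid_algebra G\<^esub> g) x * u x) =
      (\<Sum>x\<in>carrier G. \<Sum>a\<in>carrier G. \<Sum>b\<in>carrier G. f a * g b * (of_bool (a \<otimes> b = x) * u x))"
    by (simp add: monoid_algebra_mult_apply[OF fin f g] sum_distrib_right mult.assoc)
  also have "\<dots> = (\<Sum>a\<in>carrier G. \<Sum>b\<in>carrier G. \<Sum>x\<in>carrier G.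
      f a * g b * (of_bool (a \<otimes> b = x) * u x))"
    by (subst sum.swap, rule sum.cong[OF refl], rule sum.swap)
  also have "\<dots> = (\<Sum>a\<in>carrier G. \<Sum>b\<in>carrier G. f a * g b * u (a \<otimes> b))"
    by (intro sum.cong refl) (simp add: single flip: sum_distrib_left)
  finally show ?thesis .
qed

lemma (in monoid) monoid_algebra_mult_closed:
  assumes fin: "finite (carrier G)"
    and f: "f \<in> carrier (monoid_algebra G)" and g: "g \<in> carrier (monoid_algebra G)"
  shows "f \<otimes>\<^bsub>monoid_algebra G\<^esub> g \<in> carrier (monoid_algebra G)"
  unfolding carrier_monoid_algebra[OF fin]
  by (auto simp: monoid_algebra_mult_apply[OF fin f g] intro!: sum.neutral)

lemma (in monoid) basis_elem_mult:
  assumes fin: "finite (carrier G)" and x: "x \<in> carrier G" and y: "y \<in> carrier G"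
  shows "basis_elem x \<otimes>\<^bsub>monoid_algebra G\<^esub> basis_elem y = basis_elem (x \<otimes> y)"
proof
  fix z
  have "(basis_elem x \<otimes>\<^bsub>monoid_algebra G\<^esub> basis_elem y) z =
    (\<Sum>a\<in>carrier G. if a = x then \<Sum>b\<in>carrier G. if b = y then of_bool (x \<otimes> y = z) else 0 else 0)"
    unfolding monoid_algebra_mult_apply[OF fin basis_elem_closed[OF x] basis_elem_closed[OF y]]
    by (intro sum.cong refl) (auto simp: basis_elem_def intro!: sum.cong sum.neutral)
  also have "\<dots> = basis_elem (x \<otimes> y) z"
    using fin x y by (simp add: basis_elem_def)
  finally show "(basis_elem x \<otimes>\<^bsub>monoid_algebra G\<^esub> basis_elem y) z = basis_elem (x \<otimes> y) z" .
qed

text \<open>Both bracketings unfold to the same triple sum, where only associativity in the monoid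
  is left to use.\<close>

lemma (in monoid) monoid_algebra_assoc:
  assumes fin: "finite (carrier G)"
    and f: "f \<in> carrier (monoid_algebra G)" and g: "g \<in> carrier (monoid_algebra G)"
    and h: "h \<in> carrier (monoid_algebra G)"
  shows "f \<otimes>\<^bsub>monoid_algebra G\<^esub> g \<otimes>\<^bsub>monoid_algebra G\<^esub> h =
    f \<otimes>\<^bsub>monoid_algebra G\<^esub> (g \<otimes>\<^bsub>monoid_algebra G\<^esub> h)"
proof
  fix x
  note fg = monoid_algebra_mult_closed[OF fin f g] and gh = monoid_algebra_mult_closed[OF fin g h]
  have "(f \<otimes>\<^bsub>monoid_algebra G\<^esub> g \<otimes>\<^bsub>monoid_algebra G\<^esub> h) x =
      (\<Sum>y\<in>carrier G. (f \<otimes>\<^bsub>monoid_algebra G\<^esub> g) y * (\<Sum>c\<in>carrier G. h c * of_bool (y \<otimes> c = x)))"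
    by (simp add: monoid_algebra_mult_apply[OF fin fg h] sum_distrib_left mult.assoc)
  also have "\<dots> = (\<Sum>a\<in>carrier G. \<Sum>b\<in>carrier G. \<Sum>c\<in>carrier G.
      f a * g b * h c * of_bool (a \<otimes> b \<otimes> c = x))"
    \<comment> \<open>The weight paired with the product is the inner sum over \<open>c\<close>,
      seen as a function of \<open>y\<close>.\<close>
    unfolding monoid_algebra_mult_pairing[OF fin f g] by (simp add: sum_distrib_left mult.assoc)
  also have "\<dots> = (\<Sum>a\<in>carrier G. f a *
      (\<Sum>b\<in>carrier G. \<Sum>c\<in>carrier G. g b * h c * of_bool (a \<otimes> (b \<otimes> c) = x)))"
    by (simp add: sum_distrib_left mult.assoc m_assoc)
  also have "\<dots> = (\<Sum>a\<in>carrier G. f a *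
      (\<Sum>y\<in>carrier G. (g \<otimes>\<^bsub>monoid_algebra G\<^esub> h) y * of_bool (a \<otimes> y = x)))"
    unfolding monoid_algebra_mult_pairing[OF fin g h] ..
  also have "\<dots> = (f \<otimes>\<^bsub>monoid_algebra G\<^esub> (g \<otimes>\<^bsub>monoid_algebra G\<^esub> h)) x"
    by (simp add: monoid_algebra_mult_apply[OF fin f gh] sum_distrib_left mult.assoc)
  finally show "(f \<otimes>\<^bsub>monoid_algebra G\<^esub> g \<otimes>\<^bsub>monoid_algebra G\<^esub> h) x =
    (f \<otimes>\<^bsub>monoid_algebra G\<^esub> (g \<otimes>\<^bsub>monoid_algebra G\<^esub> h)) x" .
qed

lemma (in comm_monoid) monoid_algebra_cring:
  assumes fin: "finite (carrier G)"
  shows "cring (monoid_algebra G :: ('a \<Rightarrow> 'k::comm_ring_1) ring)" (is "cring ?R")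
proof (rule cringI)
  note closed = carrier_monoid_algebra[OF fin]
  show "abelian_group ?R"
  proof (rule abelian_groupI)
    fix f assume "f \<in> carrier ?R"
    then show "\<exists>g\<in>carrier ?R. g \<oplus>\<^bsub>?R\<^esub> f = \<zero>\<^bsub>?R\<^esub>"
      by (intro bexI[of _ "\<lambda>x. - f x"]) (auto simp: monoid_algebra_simps closed)
  qed (auto simp: monoid_algebra_simps closed add.assoc add.commute)
  have comm: "f \<otimes>\<^bsub>?R\<^esub> g = g \<otimes>\<^bsub>?R\<^esub> f" if f: "f \<in> carrier ?R" and g: "g \<in> carrier ?R" for f g
  proof
    fix x
    have "(f \<otimes>\<^bsub>?R\<^esub> g) x = (\<Sum>b\<in>carrier G. \<Sum>a\<in>carrier G. f a * g b * of_bool (a \<otimes> b = x))"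
      unfolding monoid_algebra_mult_apply[OF fin f g] by (rule sum.swap)
    also have "\<dots> = (g \<otimes>\<^bsub>?R\<^esub> f) x"
      unfolding monoid_algebra_mult_apply[OF fin g f]
      by (intro sum.cong refl) (simp add: m_comm mult.commute)
    finally show "(f \<otimes>\<^bsub>?R\<^esub> g) x = (g \<otimes>\<^bsub>?R\<^esub> f) x" .
  qed
  show "comm_monoid ?R"
  proof (rule comm_monoidI)
    fix f assume f: "f \<in> carrier ?R"
    show "\<one>\<^bsub>?R\<^esub> \<otimes>\<^bsub>?R\<^esub> f = f"
    proof
      fix x
      have "(\<one>\<^bsub>?R\<^esub> \<otimes>\<^bsub>?R\<^esub> f) x =
          (\<Sum>a\<in>carrier G. if a = \<one> then \<Sum>b\<in>carrier G. if b = x then f b else 0 else 0)"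
        unfolding monoid_algebra_simps
          monoid_algebra_mult_apply[OF fin basis_elem_closed[OF one_closed] f]
        by (intro sum.cong refl)
          (use f in \<open>auto simp: basis_elem_def intro!: sum.cong sum.neutral\<close>)
      also have "\<dots> = f x"
        using fin f by (auto simp: closed)
      finally show "(\<one>\<^bsub>?R\<^esub> \<otimes>\<^bsub>?R\<^esub> f) x = f x" .
    qed
  qed (auto simp: monoid_algebra_simps monoid_algebra_mult_closed fin basis_elem_closed
      monoid_algebra_assoc intro: comm)
  fix f g h assume f: "f \<in> carrier ?R" and g: "g \<in> carrier ?R" and h: "h \<in> carrier ?R"
  have fg: "f \<oplus>\<^bsub>?R\<^esub> g \<in> carrier ?R"
    using f g by (simp add: monoid_algebra_simps closed)
  show "(f \<oplus>\<^bsub>?R\<^esub> g) \<otimes>\<^bsub>?R\<^esub> h = f \<otimes>\<^bsub>?R\<^esub> h \<oplus>\<^bsub>?R\<^esub> g \<otimes>\<^bsub>?R\<^esub> h"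
    by (rule ext) (use fg in \<open>simp add: monoid_algebra_simps monoid_algebra_mult_apply
        fin f g h distrib_right sum.distrib\<close>)
qed

text \<open>Subtraction in a ring is addition of an abstract inverse, so the pointwise formula is
  obtained by adding \<open>g\<close> back and cancelling.\<close>

lemma (in comm_monoid) monoid_algebra_minus:
  fixes f g :: "'a \<Rightarrow> 'k::comm_ring_1"
  assumes fin: "finite (carrier G)"
    and f: "f \<in> carrier (monoid_algebra G)" and g: "g \<in> carrier (monoid_algebra G)"
  shows "f \<ominus>\<^bsub>monoid_algebra G\<^esub> g = (\<lambda>x. f x - g x)"
proof -
  interpret R: cring "monoid_algebra G :: ('a \<Rightarrow> 'k) ring"
    by (rule monoid_algebra_cring[OF fin])
  have d: "(\<lambda>x. f x - g x) \<in> carrier (monoid_algebra G)"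
    using f g by (simp add: carrier_monoid_algebra[OF fin])
  have "f = (\<lambda>x. f x - g x) \<oplus>\<^bsub>monoid_algebra G\<^esub> g"
    by (simp add: monoid_algebra_simps)
  then have "f \<ominus>\<^bsub>monoid_algebra G\<^esub> g =
      (\<lambda>x. f x - g x) \<oplus>\<^bsub>monoid_algebra G\<^esub> g \<ominus>\<^bsub>monoid_algebra G\<^esub> g"
    by (rule arg_cong)
  then show ?thesis
    using d g by (simp add: R.minus_eq R.a_assoc R.r_neg)
qed

text \<open>The ring structure carries no scalars. Realizing a scalar as a multiple of the identity
  makes every ideal closed under scaling.\<close>

lemma (in comm_monoid) monoid_algebra_scale:
  fixes f :: "'a \<Rightarrow> 'k::comm_ring_1"
  assumes fin: "finite (carrier G)" and f: "f \<in> carrier (monoid_algebra G)"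
  shows "(\<lambda>x. c * f x) = (\<lambda>x. c * basis_elem \<one> x) \<otimes>\<^bsub>monoid_algebra G\<^esub> f"
proof
  fix x
  have one: "(basis_elem \<one> :: 'a \<Rightarrow> 'k) \<in> carrier (monoid_algebra G)"
    by (rule basis_elem_closed) simp
  have "basis_elem \<one> \<otimes>\<^bsub>monoid_algebra G\<^esub> f = f"
    using monoid.l_one[OF ring.is_monoid[OF cring.axioms(1)[OF monoid_algebra_cring[OF fin]]] f]
    by (simp add: monoid_algebra_simps)
  then have "c * f x = c * (basis_elem \<one> \<otimes>\<^bsub>monoid_algebra G\<^esub> f) x"
    by simp
  moreover have "(\<lambda>x. c * basis_elem \<one> x) \<in> carrier (monoid_algebra G)"
    using one by (simp add: carrier_monoid_algebra[OF fin])
  ultimately show "c * f x = ((\<lambda>x. c * basis_elem \<one> x) \<otimes>\<^bsub>monoid_algebra G\<^esub> f) x"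
    by (simp add: monoid_algebra_mult_apply[OF fin _ f] one sum_distrib_left mult.assoc)
qed

section \<open>Homomorphisms induced by partially defined maps\<close>

definition partial_pushforward ::
    "('m, 'c) monoid_scheme \<Rightarrow> ('m \<Rightarrow> 'n option) \<Rightarrow> ('m \<Rightarrow> 'k::comm_ring_1) \<Rightarrow> 'n \<Rightarrow> 'k" where
  "partial_pushforward M \<tau> f = (\<lambda>c. \<Sum>a\<in>carrier M. f a * of_bool (\<tau> a = Some c))"

text \<open>Swapping the sums turns the pairing into one with the pullback of \<open>u\<close> along
  \<open>\<tau>\<close>; points where \<open>\<tau>\<close> is undefined get weight 0.\<close>

lemma partial_pushforward_pairing:
  assumes fin: "finite (carrier N)"
    and \<tau>: "\<And>a c. a \<in> carrier M \<Longrightarrow> \<tau> a = Some c \<Longrightarrow> c \<in> carrier N"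
  shows "(\<Sum>c\<in>carrier N. partial_pushforward M \<tau> f c * u c) =
    (\<Sum>a\<in>carrier M. f a * (case \<tau> a of None \<Rightarrow> 0 | Some c \<Rightarrow> u c))"
proof -
  have "(\<Sum>c\<in>carrier N. partial_pushforward M \<tau> f c * u c) =
      (\<Sum>a\<in>carrier M. f a * (\<Sum>c\<in>carrier N. if \<tau> a = Some c then u c else 0))"
    unfolding partial_pushforward_def sum_distrib_right
    by (subst sum.swap) (auto simp: sum_distrib_left mult.assoc intro!: sum.cong)
  also have "\<dots> = (\<Sum>a\<in>carrier M. f a * (case \<tau> a of None \<Rightarrow> 0 | Some c \<Rightarrow> u c))"
    using fin \<tau> by (intro sum.cong refl) (auto split: option.split)
  finally show ?thesis .
qed

text \<open>\<open>None\<close> plays the part of an absorbing zero adjoined to \<open>N\<close>: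
  the hypothesis \<open>mult\<close> makes \<open>\<tau>\<close> multiplicative into this enlarged
  monoid, and the adjoined zero becomes 0 in the algebra. The product law follows by applying the
  pairing formula to each factor.\<close>

lemma partial_pushforward_hom:
  assumes M: "comm_monoid M" "finite (carrier M)" and N: "comm_monoid N" "finite (carrier N)"
    and \<tau>: "\<And>a c. a \<in> carrier M \<Longrightarrow> \<tau> a = Some c \<Longrightarrow> c \<in> carrier N"
    and one: "\<tau> \<one>\<^bsub>M\<^esub> = Some \<one>\<^bsub>N\<^esub>"
    and mult: "\<And>a b. a \<in> carrier M \<Longrightarrow> b \<in> carrier M \<Longrightarrow> \<tau> (a \<otimes>\<^bsub>M\<^esub> b) =
      (case \<tau> a of None \<Rightarrow> None | Some c \<Rightarrow> map_option (\<lambda>d. c \<otimes>\<^bsub>N\<^esub> d) (\<tau> b))"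
  shows "partial_pushforward M \<tau> \<in> ring_hom (monoid_algebra M) (monoid_algebra N)"
proof -
  interpret M: comm_monoid M by fact
  interpret N: comm_monoid N by fact
  have closed: "partial_pushforward M \<tau> f \<in> carrier (monoid_algebra N)" for f :: "'a \<Rightarrow> 'e"
    using \<tau> by (auto simp: carrier_monoid_algebra N partial_pushforward_def intro!: sum.neutral)
  show ?thesis
  proof (rule ring_hom_memI)
    fix f g :: "'a \<Rightarrow> 'e"
    assume f: "f \<in> carrier (monoid_algebra M)" and g: "g \<in> carrier (monoid_algebra M)"
    show "partial_pushforward M \<tau> f \<in> carrier (monoid_algebra N)"
      by (rule closed)
    show "partial_pushforward M \<tau> (f \<oplus>\<^bsub>monoid_algebra M\<^esub> g) =
        partial_pushforward M \<tau> f \<oplus>\<^bsub>monoid_algebra N\<^esub> partial_pushforward M \<tau> g"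
      by (simp add: monoid_algebra_simps partial_pushforward_def distrib_right sum.distrib)
    show "partial_pushforward M \<tau> (f \<otimes>\<^bsub>monoid_algebra M\<^esub> g) =
        partial_pushforward M \<tau> f \<otimes>\<^bsub>monoid_algebra N\<^esub> partial_pushforward M \<tau> g"
    proof
      fix x
      have "(partial_pushforward M \<tau> f \<otimes>\<^bsub>monoid_algebra N\<^esub> partial_pushforward M \<tau> g) x =
          (\<Sum>c\<in>carrier N. partial_pushforward M \<tau> f c *
            (\<Sum>d\<in>carrier N. partial_pushforward M \<tau> g d * of_bool (c \<otimes>\<^bsub>N\<^esub> d = x)))"
        by (simp add: monoid_algebra_mult_apply[OF N(2) closed closed] sum_distrib_left mult.assoc)
      also have "\<dots> = (\<Sum>a\<in>carrier M. f a * (case \<tau> a of None \<Rightarrow> 0 | Some c \<Rightarrow>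
          (\<Sum>d\<in>carrier N. partial_pushforward M \<tau> g d * of_bool (c \<otimes>\<^bsub>N\<^esub> d = x))))"
        by (rule partial_pushforward_pairing[OF N(2) \<tau>])
      also have "\<dots> = (\<Sum>a\<in>carrier M. f a * (case \<tau> a of None \<Rightarrow> 0 | Some c \<Rightarrow>
          (\<Sum>b\<in>carrier M. g b * (case \<tau> b of None \<Rightarrow> 0 | Some d \<Rightarrow> of_bool (c \<otimes>\<^bsub>N\<^esub> d = x)))))"
        by (simp only: partial_pushforward_pairing[OF N(2) \<tau>])
      also have "\<dots> = (\<Sum>a\<in>carrier M. \<Sum>b\<in>carrier M.
          f a * g b * of_bool (\<tau> (a \<otimes>\<^bsub>M\<^esub> b) = Some x))"
        by (intro sum.cong refl)
          (auto simp: mult sum_distrib_left mult.assoc intro!: sum.cong split: option.split)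
      also have "\<dots> = partial_pushforward M \<tau> (f \<otimes>\<^bsub>monoid_algebra M\<^esub> g) x"
        unfolding partial_pushforward_def by (rule M.monoid_algebra_mult_pairing[OF M(2) f g, symmetric])
      finally show "partial_pushforward M \<tau> (f \<otimes>\<^bsub>monoid_algebra M\<^esub> g) x =
        (partial_pushforward M \<tau> f \<otimes>\<^bsub>monoid_algebra N\<^esub> partial_pushforward M \<tau> g) x" ..
    qed
  next
    show "partial_pushforward M \<tau> \<one>\<^bsub>monoid_algebra M\<^esub> = \<one>\<^bsub>monoid_algebra N\<^esub>"
    proof
      fix x
      have "partial_pushforward M \<tau> \<one>\<^bsub>monoid_algebra M\<^esub> x =
          (\<Sum>a\<in>carrier M. if a = \<one>\<^bsub>M\<^esub> then of_bool (\<tau> a = Some x) else 0)"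
        unfolding partial_pushforward_def
        by (intro sum.cong) (auto simp: monoid_algebra_simps basis_elem_def)
      also have "\<dots> = \<one>\<^bsub>monoid_algebra N\<^esub> x"
        using M(2) one by (auto simp: monoid_algebra_simps basis_elem_def)
      finally show "partial_pushforward M \<tau> \<one>\<^bsub>monoid_algebra M\<^esub> x = \<one>\<^bsub>monoid_algebra N\<^esub> x" .
    qed
  qed
qed

section \<open>Group algebras over ordered fields are reduced\<close>

text \<open>With \<open>f\<^sup>*(x) = f(x\<inverse>)\<close>, the coefficient of \<open>f f\<^sup>*\<close> at the identity is the sum of the squares
  of the coefficients of \<open>f\<close>, so \<open>f f\<^sup>* = 0\<close> forces \<open>f = 0\<close>. If \<open>f\<^sup>2 = 0\<close>, then \<open>h = f f\<^sup>*\<close>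
  satisfies \<open>h h\<^sup>* = h\<^sup>2 = 0\<close>, whence \<open>h = 0\<close> and \<open>f = 0\<close>.\<close>

lemma (in comm_group) group_algebra_square_zero:
  fixes f :: "'a \<Rightarrow> 'k::linordered_field"
  assumes fin: "finite (carrier G)" and f: "f \<in> carrier (monoid_algebra G)"
    and sq: "f \<otimes>\<^bsub>monoid_algebra G\<^esub> f = \<zero>\<^bsub>monoid_algebra G\<^esub>"
  shows "f = \<zero>\<^bsub>monoid_algebra G\<^esub>"
proof -
  let ?R = "monoid_algebra G :: ('a \<Rightarrow> 'k) ring"
  interpret R: cring ?R by (rule monoid_algebra_cring[OF fin])
  note closed = carrier_monoid_algebra[OF fin]
  define star where "star f = (\<lambda>x. if x \<in> carrier G then f (inv x) else 0)" for f :: "'a \<Rightarrow> 'k"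
  have star_closed: "star f \<in> carrier ?R" for f
    by (simp add: star_def closed)
  have definite: "f = (\<lambda>x. 0)"
    if f: "f \<in> carrier ?R" and 0: "f \<otimes>\<^bsub>?R\<^esub> star f = (\<lambda>x. 0)" for f
  proof -
    have "(f \<otimes>\<^bsub>?R\<^esub> star f) \<one> =
        (\<Sum>a\<in>carrier G. \<Sum>b\<in>carrier G. if b = inv a then f a * f a else 0)"
      unfolding monoid_algebra_mult_apply[OF fin f star_closed]
      by (intro sum.cong refl) (auto simp: star_def dest: comm_inv_char)
    also have "\<dots> = (\<Sum>a\<in>carrier G. f a * f a)"
      using fin by simp
    finally have "\<forall>a\<in>carrier G. f a * f a = 0"
      using 0 fin by (simp add: sum_nonneg_eq_0_iff)
    then show ?thesis
      using f by (auto simp: closed)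
  qed
  have star_mult: "star (f \<otimes>\<^bsub>?R\<^esub> g) = star f \<otimes>\<^bsub>?R\<^esub> star g"
    if f: "f \<in> carrier ?R" and g: "g \<in> carrier ?R" for f g
  proof
    fix x
    \<comment> \<open>Inversion permutes the group, so both summation variables may be replaced by
      their inverses.\<close>
    have bij: "bij_betw (\<lambda>x. inv x) (carrier G) (carrier G)"
      by (rule bij_betw_byWitness[where f' = "\<lambda>x. inv x"]) auto
    show "star (f \<otimes>\<^bsub>?R\<^esub> g) x = (star f \<otimes>\<^bsub>?R\<^esub> star g) x"
    proof (cases "x \<in> carrier G")
      case True
      have "star (f \<otimes>\<^bsub>?R\<^esub> g) x =
          (\<Sum>a\<in>carrier G. \<Sum>b\<in>carrier G. f a * g b * of_bool (a \<otimes> b = inv x))"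
        using True by (simp add: star_def monoid_algebra_mult_apply[OF fin f g])
      also have "\<dots> = (\<Sum>a\<in>carrier G. \<Sum>b\<in>carrier G. f a * g (inv b) * of_bool (a \<otimes> inv b = inv x))"
        by (rule sum.cong[OF refl], rule sum.reindex_bij_betw[OF bij, symmetric])
      also have "\<dots> = (\<Sum>a\<in>carrier G. \<Sum>b\<in>carrier G.
          f (inv a) * g (inv b) * of_bool (inv a \<otimes> inv b = inv x))"
        by (rule sum.reindex_bij_betw[OF bij, symmetric])
      also have "\<dots> = (star f \<otimes>\<^bsub>?R\<^esub> star g) x"
        unfolding monoid_algebra_mult_apply[OF fin star_closed star_closed]
        using True by (intro sum.cong refl) (auto simp: star_def simp flip: inv_mult)
      finally show ?thesis .
    next
      case False
      then show ?thesis
        using R.m_closed[OF star_closed star_closed] by (simp add: closed star_def)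
    qed
  qed
  let ?h = "f \<otimes>\<^bsub>?R\<^esub> star f"
  have h: "?h \<in> carrier ?R"
    using f star_closed by simp
  have "star (star f) = f"
    using f by (auto simp: star_def closed)
  then have "star ?h = ?h"
    using f by (simp add: star_mult star_closed R.m_comm)
  \<comment> \<open>Commutativity collects the two copies of \<open>f\<close> into their square,
    which is zero.\<close>
  moreover have "?h \<otimes>\<^bsub>?R\<^esub> ?h = (f \<otimes>\<^bsub>?R\<^esub> f) \<otimes>\<^bsub>?R\<^esub> (star f \<otimes>\<^bsub>?R\<^esub> star f)"
    using f star_closed by (simp add: R.m_ac)
  then have "?h \<otimes>\<^bsub>?R\<^esub> ?h = \<zero>\<^bsub>?R\<^esub>"
    using R.l_null[OF R.m_closed[OF star_closed star_closed]] unfolding sq by metis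
  ultimately have "?h = \<zero>\<^bsub>?R\<^esub>"
    using definite[OF h] by (simp add: monoid_algebra_simps)
  then show ?thesis
    using definite[OF f] by (simp add: monoid_algebra_simps)
qed

text \<open>Descent on the exponent: for \<open>n \<ge> 2\<close> the square of
  \<open>x^(n-1)\<close> has exponent \<open>2n - 2 \<ge> n\<close>, so it vanishes and the exponent
  drops by one. For \<open>n = 0\<close> the ring itself is zero.\<close>

lemma (in cring) reduced_if_square_zero:
  assumes sq: "\<And>x. x \<in> carrier R \<Longrightarrow> x \<otimes> x = \<zero> \<Longrightarrow> x = \<zero>"
    and x: "x \<in> carrier R" and pow: "x [^] (n::nat) = \<zero>"
  shows "x = \<zero>"
  using pow
proof (induction n rule: less_induct)
  case (less n)
  consider "n = 0" | "n = 1" | "n \<ge> 2" by linarith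
  then show ?case
  proof cases
    case 1
    then show ?thesis using less.prems x by (metis l_null l_one nat_pow_0)
  next
    case 2
    then show ?thesis using less.prems x by simp
  next
    case 3
    have "n - 1 + (n - 1) = n + (n - 2)"
      using 3 by simp
    then have "x [^] (n - 1) \<otimes> x [^] (n - 1) = x [^] n \<otimes> x [^] (n - 2)"
      unfolding nat_pow_mult[OF x] by (rule arg_cong)
    then have "x [^] (n - 1) \<otimes> x [^] (n - 1) = \<zero>"
      unfolding less.prems using l_null[OF nat_pow_closed[OF x]] by metis
    then have "x [^] (n - 1) = \<zero>"
      by (rule sq[OF nat_pow_closed[OF x]])
    then show ?thesis
      by (rule less.IH[rotated]) (use 3 in linarith)
  qed
qed

lemma (in comm_group) group_algebra_reduced:
  fixes f :: "'a \<Rightarrow> 'k::linordered_field"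
  assumes fin: "finite (carrier G)" and f: "f \<in> carrier (monoid_algebra G)"
    and pow: "f [^]\<^bsub>monoid_algebra G\<^esub> (n::nat) = \<zero>\<^bsub>monoid_algebra G\<^esub>"
  shows "f = \<zero>\<^bsub>monoid_algebra G\<^esub>"
  by (rule cring.reduced_if_square_zero[OF monoid_algebra_cring[OF fin] _ f pow])
    (rule group_algebra_square_zero[OF fin])

section \<open>Finite products of rings\<close>

lemma product_ring_simps:
  "carrier (product_ring I S) = (\<Pi>\<^sub>E i\<in>I. carrier (S i))"
  "x \<otimes>\<^bsub>product_ring I S\<^esub> y = (\<lambda>i\<in>I. x i \<otimes>\<^bsub>S i\<^esub> y i)"
  "\<one>\<^bsub>product_ring I S\<^esub> = (\<lambda>i\<in>I. \<one>\<^bsub>S i\<^esub>)"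
  "\<zero>\<^bsub>product_ring I S\<^esub> = (\<lambda>i\<in>I. \<zero>\<^bsub>S i\<^esub>)"
  "x \<oplus>\<^bsub>product_ring I S\<^esub> y = (\<lambda>i\<in>I. x i \<oplus>\<^bsub>S i\<^esub> y i)"
  by (simp_all add: product_ring_def)

lemma product_ring_eqI:
  assumes "x \<in> carrier (product_ring I S)" "y \<in> extensional I" "\<And>i. i \<in> I \<Longrightarrow> x i = y i"
  shows "x = y"
  using assms by (intro extensionalityI[of x I]) (simp_all add: product_ring_simps PiE_iff)

lemma product_ring_cring:
  assumes S: "\<And>i. i \<in> I \<Longrightarrow> cring (S i)"
  shows "cring (product_ring I S)"
proof (rule cringI)
  note laws = cring.cring_simprules[OF S]
  show "abelian_group (product_ring I S)"
  proof (rule abelian_groupI)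
    fix x assume "x \<in> carrier (product_ring I S)"
    then show "\<exists>y\<in>carrier (product_ring I S).
        y \<oplus>\<^bsub>product_ring I S\<^esub> x = \<zero>\<^bsub>product_ring I S\<^esub>"
      by (intro bexI[of _ "\<lambda>i\<in>I. \<ominus>\<^bsub>S i\<^esub> x i"])
        (auto simp: product_ring_simps laws PiE_iff intro!: restrict_ext)
  qed (auto simp: product_ring_simps laws PiE_iff intro!: restrict_ext
      intro: extensionalityI[of _ I])
  show "comm_monoid (product_ring I S)"
  proof (rule comm_monoidI)
    fix x assume "x \<in> carrier (product_ring I S)"
    then show "\<one>\<^bsub>product_ring I S\<^esub> \<otimes>\<^bsub>product_ring I S\<^esub> x = x"
      by (intro extensionalityI[of _ I])
        (auto simp: product_ring_simps PiE_iff S cring.axioms(1) monoid.l_one ring.is_monoid)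
  qed (auto simp: product_ring_simps laws PiE_iff intro!: restrict_ext)
qed (auto simp: product_ring_simps cring.cring_simprules[OF S] PiE_iff intro!: restrict_ext)

lemma product_ring_proj_hom:
  "i \<in> I \<Longrightarrow> (\<lambda>x. x i) \<in> ring_hom (product_ring I S) (S i)"
  by (auto intro!: ring_hom_memI simp: product_ring_simps)

lemma product_ring_tuple_hom:
  assumes "\<And>i. i \<in> I \<Longrightarrow> h i \<in> ring_hom R (S i)"
  shows "(\<lambda>x. \<lambda>i\<in>I. h i x) \<in> ring_hom R (product_ring I S)"
  by (auto intro!: ring_hom_memI restrict_ext simp: product_ring_simps ring_hom_mult[OF assms]
      ring_hom_add[OF assms] ring_hom_one[OF assms] intro: ring_hom_closed[OF assms])

section \<open>The Jacobson radical of a finite-dimensional commutative algebra\<close>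

text \<open>Zorn's lemma for the ideals that contain \<open>I\<close> and avoid
  \<open>\<one>\<close>: unions of chains avoid it as well, and any ideal strictly above a maximal
  member contains \<open>\<one>\<close>.\<close>

lemma (in cring) exists_maximalideal:
  assumes I: "ideal I R" and one: "\<one> \<notin> I"
  obtains M where "maximalideal M R" "I \<subseteq> M"
proof -
  let ?A = "{J. ideal J R \<and> I \<subseteq> J \<and> \<one> \<notin> J}"
  have "\<exists>M\<in>?A. \<forall>Y\<in>?A. M \<subseteq> Y \<longrightarrow> Y = M"
  proof (rule subset_Zorn)
    fix C assume C: "subset.chain ?A C"
    show "\<exists>U\<in>?A. \<forall>Y\<in>C. Y \<subseteq> U"
    proof (cases "C = {}")
      case True
      then show ?thesis using I one by auto
    next
      case False
      have "subset.chain {J. ideal J R} C"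
        using C by (auto simp: pred_on.chain_def)
      then have "ideal (\<Union>C) R"
        using chain_Union_is_ideal[of C] False by simp
      moreover have "\<one> \<notin> \<Union>C" "I \<subseteq> \<Union>C"
        using C False unfolding pred_on.chain_def by blast+
      ultimately show ?thesis by auto
    qed
  qed
  then obtain M where "M \<in> ?A" and max: "\<forall>Y\<in>?A. M \<subseteq> Y \<longrightarrow> Y = M"
    by (elim bexE)
  then have M: "ideal M R" "I \<subseteq> M" "\<one> \<notin> M"
    by simp_all
  have "maximalideal M R"
  proof (rule maximalidealI[OF M(1)])
    show "carrier R \<noteq> M" using M(3) by auto
    fix J assume "ideal J R" "M \<subseteq> J" "J \<subseteq> carrier R"
    then show "J = M \<or> J = carrier R"
      using bspec[OF max, of J] M(2) ideal.one_imp_carrier[of J R] by auto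
  qed
  then show thesis using M(2) that by blast
qed

text \<open>For \<open>x\<close> in the radical, \<open>1 - xg\<close> is a unit, since no maximal
  ideal contains both \<open>x\<close> and \<open>1 - xg\<close>. The hypothesis \<open>pow\<close>
  amounts to \<open>x^n (1 - xg) = 0\<close>.\<close>

lemma (in cring) jacobson_radical_pow_zero:
  assumes x: "x \<in> jacobson_radical R" and g: "g \<in> carrier R"
    and pow: "x [^] (n::nat) = x [^] (Suc n) \<otimes> g"
  shows "x [^] n = \<zero>"
proof -
  let ?y = "\<one> \<ominus> x \<otimes> g"
  have xc: "x \<in> carrier R"
    using x by (simp add: jacobson_radical_def)
  have "\<one> \<in> PIdl ?y"
  proof (rule ccontr)
    assume "\<one> \<notin> PIdl ?y"
    then obtain M where M: "maximalideal M R" "PIdl ?y \<subseteq> M"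
      using exists_maximalideal cgenideal_ideal xc g
      by (metis m_closed minus_closed one_closed)
    interpret M: maximalideal M R by fact
    have "?y \<in> carrier R"
      using xc g by simp
    then have "?y \<in> M"
      by (rule subsetD[OF M(2) cgenideal_self])
    moreover have "x \<in> M"
      using x M(1) unfolding jacobson_radical_def by blast
    then have "x \<otimes> g \<in> M"
      by (rule M.I_r_closed[OF _ g])
    ultimately have "?y \<oplus> x \<otimes> g \<in> M" by simp
    moreover have "?y \<oplus> x \<otimes> g = \<one>"
      using xc g by (simp add: minus_eq a_assoc l_neg)
    ultimately show False
      using M.one_imp_carrier M.I_notcarr by auto
  qed
  then obtain u where u: "u \<in> carrier R" "\<one> = u \<otimes> ?y"
    by (auto simp: cgenideal_def)
  have "x [^] n \<otimes> ?y = x [^] n \<ominus> x [^] (Suc n) \<otimes> g"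
    using xc g by (simp add: minus_eq r_distr r_minus m_assoc)
  also have "\<dots> = \<zero>"
    unfolding pow[symmetric] using xc by (simp add: minus_eq r_neg)
  finally have "x [^] n \<otimes> ?y = \<zero>" .
  moreover have "x [^] n = u \<otimes> (x [^] n \<otimes> ?y)"
    using u xc g by (metis m_lcomm r_one nat_pow_closed m_closed minus_closed one_closed)
  ultimately show ?thesis using u by simp
qed

text \<open>Maximal ideals are prime, so each of them contains \<open>x\<close> as soon as it
  contains the power that is \<open>\<zero>\<close>.\<close>

lemma (in cring) nilpotent_imp_jacobson_radical:
  assumes x: "x \<in> carrier R" and pow: "x [^] (n::nat) = \<zero>"
  shows "x \<in> jacobson_radical R"
proof -
  have "x \<in> M" if "maximalideal M R" for M
  proof -
    interpret M: primeideal M R by (rule maximalideal_prime[OF that])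
    have "x [^] (k::nat) \<in> M \<Longrightarrow> x \<in> M" for k
    proof (induction k)
      case 0
      then show ?case using M.one_imp_carrier x by simp
    next
      case (Suc k)
      then show ?case using M.I_prime[of "x [^] k" x] x by auto
    qed
    then show ?thesis using pow M.zero_closed by metis
  qed
  then show ?thesis using x by (simp add: jacobson_radical_def)
qed

section \<open>Descending chains in finite dimension\<close>

lemma (in vector_space) decreasing_subspaces_stabilize:
  assumes T: "finite T" and V: "\<And>n::nat. V n \<subseteq> span T"
    and sub: "\<And>n. subspace (V n)" and dec: "\<And>n. V (Suc n) \<subseteq> V n"
  obtains n where "V (Suc n) = V n"
proof -
  \<comment> \<open>At an index of least dimension the next subspace has the same dimension, so
    extending a basis of it to one of \<open>V n\<close> adds nothing.\<close>
  obtain n where n: "\<And>m. dim (V n) \<le> dim (V m)"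
    using ex_has_least_nat[of "\<lambda>_. True" 0 "\<lambda>n. dim (V n)"] by auto
  obtain B where B: "B \<subseteq> V (Suc n)" "independent B" "V (Suc n) \<subseteq> span B" "card B = dim (V (Suc n))"
    by (rule basis_exists)
  obtain C where C: "B \<subseteq> C" "C \<subseteq> V n" "independent C" "V n \<subseteq> span C"
    using maximal_independent_subset_extend[of B "V n"] B dec by blast
  have "finite C"
    using independent_span_bound[OF T C(3)] C(2) V by blast
  moreover have "card C = dim (V n)"
    using C by (intro basis_card_eq_dim)
  ultimately have "B = C"
    using C(1) B(4) n[of "Suc n"] by (intro card_seteq) auto
  then have "V n \<subseteq> V (Suc n)"
    using C(4) span_minimal[OF B(1) sub] by blast
  then show thesis using dec that by blast
qed

text \<open>The closure properties are spelled out pointwise so that the result serves both for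
  linear spans and for ideals of a monoid algebra.\<close>

lemma subspace_sum_scaled:
  fixes V :: "('b \<Rightarrow> 'k::comm_ring_1) set"
  assumes zero: "(\<lambda>x. 0) \<in> V" and add: "\<And>v w. v \<in> V \<Longrightarrow> w \<in> V \<Longrightarrow> (\<lambda>x. v x + w x) \<in> V"
    and mult: "\<And>c v. v \<in> V \<Longrightarrow> (\<lambda>x. c * v x) \<in> V"
    and v: "\<And>a. a \<in> A \<Longrightarrow> v a \<in> V"
  shows "(\<lambda>x. \<Sum>a\<in>A. c a * v a x) \<in> V"
  using v
proof (induction A rule: infinite_finite_induct)
  case (insert a A)
  then show ?case using add[OF mult[of "v a" "c a"], of "\<lambda>x. \<Sum>a\<in>A. c a * v a x"] by simp
qed (simp_all add: zero)

text \<open>The algebra is spanned by finitely many basis elements, so the descending chain of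
  principal ideals \<open>f^n R\<close> has two equal successive terms.\<close>

lemma (in comm_monoid) monoid_algebra_power_stabilizes:
  fixes f :: "'a \<Rightarrow> 'k::field"
  assumes fin: "finite (carrier G)" and f: "f \<in> carrier (monoid_algebra G)"
  obtains n :: nat and g where "g \<in> carrier (monoid_algebra G)"
    "f [^]\<^bsub>monoid_algebra G\<^esub> n = f [^]\<^bsub>monoid_algebra G\<^esub> Suc n \<otimes>\<^bsub>monoid_algebra G\<^esub> g"
proof -
  let ?R = "monoid_algebra G :: ('a \<Rightarrow> 'k) ring"
  let ?scale = "\<lambda>(c::'k) (f::'a \<Rightarrow> 'k) x. c * f x"
  interpret R: cring ?R by (rule monoid_algebra_cring[OF fin])
  interpret V: vector_space ?scale
    by unfold_locales (auto simp: algebra_simps plus_fun_def)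
  define W where "W n = (\<lambda>x. f [^]\<^bsub>?R\<^esub> (n::nat) \<otimes>\<^bsub>?R\<^esub> x) ` carrier ?R" for n
  have scale: "?scale c (x \<otimes>\<^bsub>?R\<^esub> y) = x \<otimes>\<^bsub>?R\<^esub> ?scale c y" "?scale c y \<in> carrier ?R"
    if x: "x \<in> carrier ?R" and y: "y \<in> carrier ?R" for c x y
  proof -
    show closed: "?scale c y \<in> carrier ?R"
      using y by (simp add: carrier_monoid_algebra[OF fin])
    show "?scale c (x \<otimes>\<^bsub>?R\<^esub> y) = x \<otimes>\<^bsub>?R\<^esub> ?scale c y"
      by (rule ext) (use closed in \<open>simp add: monoid_algebra_mult_apply[OF fin] x y sum_distrib_left mult_ac\<close>)
  qed
  have spanning: "carrier ?R \<subseteq> V.span (basis_elem ` carrier G)"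
  proof
    fix x assume x: "x \<in> carrier ?R"
    have "x = (\<lambda>z. \<Sum>a\<in>carrier G. x a * basis_elem a z)"
    proof
      fix z
      have "(\<Sum>a\<in>carrier G. x a * basis_elem a z) = (\<Sum>a\<in>carrier G. if a = z then x a else 0)"
        by (intro sum.cong) (auto simp: basis_elem_def)
      then show "x z = (\<Sum>a\<in>carrier G. x a * basis_elem a z)"
        using fin x by (simp add: carrier_monoid_algebra[OF fin])
    qed
    also have "\<dots> \<in> V.span (basis_elem ` carrier G)"
      using V.span_zero V.span_add V.span_scale V.span_base
      by (intro subspace_sum_scaled) (auto simp: zero_fun_def plus_fun_def)
    finally show "x \<in> V.span (basis_elem ` carrier G)" .
  qed
  have sub: "V.subspace (W n)" for n
  proof (rule V.subspaceI)
    have "0 = f [^]\<^bsub>?R\<^esub> n \<otimes>\<^bsub>?R\<^esub> \<zero>\<^bsub>?R\<^esub>"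
      using R.r_null[OF R.nat_pow_closed[OF f]] by (simp add: monoid_algebra_simps(1) zero_fun_def)
    then show "0 \<in> W n"
      unfolding W_def using R.zero_closed by (intro image_eqI[where x = "\<zero>\<^bsub>?R\<^esub>"])
  next
    fix x y assume "x \<in> W n" "y \<in> W n"
    then obtain x' y' where "x' \<in> carrier ?R" "y' \<in> carrier ?R"
      and xy: "x = f [^]\<^bsub>?R\<^esub> n \<otimes>\<^bsub>?R\<^esub> x'" "y = f [^]\<^bsub>?R\<^esub> n \<otimes>\<^bsub>?R\<^esub> y'"
      by (auto simp: W_def)
    then have "f [^]\<^bsub>?R\<^esub> n \<otimes>\<^bsub>?R\<^esub> (x' \<oplus>\<^bsub>?R\<^esub> y') = x \<oplus>\<^bsub>?R\<^esub> y" "x' \<oplus>\<^bsub>?R\<^esub> y' \<in> carrier ?R"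
      using f by (simp_all add: R.r_distr)
    then show "x + y \<in> W n"
      unfolding W_def by (intro image_eqI[of _ _ "x' \<oplus>\<^bsub>?R\<^esub> y'"])
        (simp_all add: monoid_algebra_simps(3) plus_fun_def)
  next
    fix c x assume "x \<in> W n"
    then show "?scale c x \<in> W n"
      using scale[of "f [^]\<^bsub>?R\<^esub> n" _ c] f by (auto simp: W_def)
  qed
  have dec: "W (Suc n) \<subseteq> W n" for n
    using f by (auto simp: W_def R.m_assoc)
  have "W n \<subseteq> V.span (basis_elem ` carrier G)" for n
    using f spanning by (auto simp: W_def)
  then obtain n where n: "W (Suc n) = W n"
    using V.decreasing_subspaces_stabilize[of "basis_elem ` carrier G" W] fin sub dec by blast
  \<comment> \<open>Since \<open>f^n\<close> is a multiple of itself, the equality of successive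
    ideals makes it a multiple of \<open>f^(n+1)\<close>.\<close>
  have "f [^]\<^bsub>?R\<^esub> n \<in> W n"
    unfolding W_def using f by (intro image_eqI[of _ _ "\<one>\<^bsub>?R\<^esub>"]) auto
  then have "f [^]\<^bsub>?R\<^esub> n \<in> W (Suc n)"
    using n by simp
  then show thesis
    using that by (auto simp: W_def simp del: R.nat_pow_Suc)
qed

lemma FactRing_carrierE:
  assumes "Y \<in> carrier (R Quot I)"
  obtains x where "x \<in> carrier R" "Y = I +>\<^bsub>R\<^esub> x"
  using assms by (auto simp: FactRing_def A_RCOSETS_def')

text \<open>A representative satisfies \<open>f^n = f^(n+1) g\<close> in the monoid algebra. This
  relation passes to the quotient, where it forces an element of the radical to be
  nilpotent.\<close>

lemma (in comm_monoid) monoid_algebra_quotient_jacobson_nilpotent: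
  fixes I :: "('a \<Rightarrow> 'k::field) set"
  assumes fin: "finite (carrier G)" and I: "ideal I (monoid_algebra G)"
    and x: "x \<in> jacobson_radical (monoid_algebra G Quot I)"
  obtains n :: nat where "x [^]\<^bsub>monoid_algebra G Quot I\<^esub> n = \<zero>\<^bsub>monoid_algebra G Quot I\<^esub>"
proof -
  let ?R = "monoid_algebra G :: ('a \<Rightarrow> 'k) ring"
  interpret R: cring ?R by (rule monoid_algebra_cring[OF fin])
  interpret I: ideal I ?R by (rule I)
  interpret Q: cring "?R Quot I" by (rule I.quotient_is_cring[OF R.is_cring])
  interpret h: ring_hom_cring ?R "?R Quot I" "(+>\<^bsub>?R\<^esub>) I"
    by (rule I.rcos_ring_hom_cring[OF R.is_cring])
  obtain f where f: "f \<in> carrier ?R" and xf: "x = I +>\<^bsub>?R\<^esub> f"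
    by (rule FactRing_carrierE[OF IntD1[OF x[unfolded jacobson_radical_def]]])
  obtain n :: nat and g where g: "g \<in> carrier ?R"
    and "f [^]\<^bsub>?R\<^esub> n = f [^]\<^bsub>?R\<^esub> Suc n \<otimes>\<^bsub>?R\<^esub> g"
    by (rule monoid_algebra_power_stabilizes[OF fin f])
  then have "I +>\<^bsub>?R\<^esub> (f [^]\<^bsub>?R\<^esub> n) = I +>\<^bsub>?R\<^esub> (f [^]\<^bsub>?R\<^esub> Suc n \<otimes>\<^bsub>?R\<^esub> g)"
    by simp
  moreover have pow: "I +>\<^bsub>?R\<^esub> (f [^]\<^bsub>?R\<^esub> k) = x [^]\<^bsub>?R Quot I\<^esub> k" for k :: nat
    unfolding xf by (induction k) (use f in simp_all)
  moreover have "I +>\<^bsub>?R\<^esub> (f [^]\<^bsub>?R\<^esub> Suc n \<otimes>\<^bsub>?R\<^esub> g) =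
      (I +>\<^bsub>?R\<^esub> (f [^]\<^bsub>?R\<^esub> Suc n)) \<otimes>\<^bsub>?R Quot I\<^esub> (I +>\<^bsub>?R\<^esub> g)"
    by (rule h.hom_mult[OF R.nat_pow_closed[OF f] g])
  ultimately have "x [^]\<^bsub>?R Quot I\<^esub> n = x [^]\<^bsub>?R Quot I\<^esub> Suc n \<otimes>\<^bsub>?R Quot I\<^esub> (I +>\<^bsub>?R\<^esub> g)"
    by metis
  then have "x [^]\<^bsub>?R Quot I\<^esub> n = \<zero>\<^bsub>?R Quot I\<^esub>"
    by (rule Q.jacobson_radical_pow_zero[OF x h.hom_closed[OF g]])
  then show thesis
    by (rule that)
qed

section \<open>Idempotent powers\<close>

lemma (in monoid) idempotent_nat_pow:
  assumes "e \<in> carrier G" "e \<otimes> e = e" "k \<ge> 1"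
  shows "e [^] (k::nat) = e"
  using assms(3) by (induction k rule: dec_induct) (use assms in simp_all)

text \<open>By the pigeonhole principle the powers are periodic from some exponent \<open>i\<close>
  on, with period \<open>p\<close>. A positive multiple of \<open>p\<close> that is at least
  \<open>i\<close> is an exponent of an idempotent power.\<close>

lemma (in monoid) idempotent_power_exists:
  assumes fin: "finite (carrier G)" and x: "x \<in> carrier G"
  obtains k :: nat where "k \<ge> 1" "x [^] k \<otimes> x [^] k = x [^] k"
proof -
  have "\<not> inj (\<lambda>n::nat. x [^] n)"
    using finite_subset[OF _ fin, of "range (\<lambda>n::nat. x [^] n)"] x finite_imageD by fastforce
  then obtain i j :: nat where ij: "i < j" "x [^] i = x [^] j"
    unfolding inj_def by (metis linorder_neqE_nat)
  define p where "p = j - i"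
  have p: "p \<ge> 1" "x [^] (i + p) = x [^] i"
    using ij by (simp_all add: p_def)
  have period: "x [^] (i + m + q * p) = x [^] (i + m)" for m q :: nat
  proof (induction q)
    case (Suc q)
    have "x [^] (i + m + Suc q * p) = x [^] (i + p) \<otimes> x [^] (m + q * p)"
      using x by (simp add: nat_pow_mult add_ac)
    also have "\<dots> = x [^] (i + m + q * p)"
      using x unfolding p(2) by (simp add: nat_pow_mult add_ac)
    finally show ?case using Suc by simp
  qed simp
  \<comment> \<open>The factor is \<open>Suc i\<close> rather than \<open>i\<close>, so that
    \<open>k\<close> is positive even when \<open>i = 0\<close>.\<close>
  define k where "k = Suc i * p"
  have k: "k \<ge> 1" "k \<ge> i"
    using p(1) by (simp_all add: k_def trans_le_add1 trans_le_add2)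
  have "x [^] k \<otimes> x [^] k = x [^] (i + (k - i) + Suc i * p)"
    using x k(2) by (simp only: nat_pow_mult k_def) simp
  also have "\<dots> = x [^] k"
    unfolding period using k(2) by simp
  finally show thesis
    using that k(1) by blast
qed

text \<open>Both idempotents equal \<open>x^(i*j)\<close>.\<close>

lemma (in monoid) idempotent_power_unique:
  assumes x: "x \<in> carrier G" and ij: "i \<ge> 1" "j \<ge> 1"
    and "x [^] (i::nat) \<otimes> x [^] i = x [^] i" "x [^] (j::nat) \<otimes> x [^] j = x [^] j"
  shows "x [^] i = x [^] j"
  using assms idempotent_nat_pow[of "x [^] i" j] idempotent_nat_pow[of "x [^] j" i]
  by (simp add: nat_pow_pow mult.commute)

text \<open>Here \<open>ae - a = a(e - 1)\<close>, and since \<open>k\<close> is positive its power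
  \<open>k\<close> has the factor \<open>e(e - 1) = 0\<close>.\<close>

lemma (in cring) idempotent_power_nilpotent:
  assumes a: "a \<in> carrier R" and e: "e \<in> carrier R" "e \<otimes> e = e"
    and k: "a [^] (k::nat) = e" "k \<ge> 1"
  shows "(a \<otimes> e \<ominus> a) [^] k = \<zero>"
proof -
  have "(a \<otimes> e \<ominus> a) [^] k = (a \<otimes> (e \<ominus> \<one>)) [^] k"
    using a e by (simp add: minus_eq r_distr r_minus)
  also have "\<dots> = e \<otimes> (e \<ominus> \<one>) [^] k"
    using a e k by (simp add: nat_pow_distrib)
  also have "\<dots> = e \<otimes> (e \<ominus> \<one>) \<otimes> (e \<ominus> \<one>) [^] (k - 1)"
    using k(2) e by (cases k) (simp_all add: m_ac)
  also have "e \<otimes> (e \<ominus> \<one>) = \<zero>"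
    using e by (simp add: minus_eq r_distr r_minus r_neg)
  finally show ?thesis
    using e by simp
qed

text \<open>Multiplication by an element of \<open>H\<close> is an injective self-map of a finite
  set, hence surjective; suitable preimages are the identity and the inverses.\<close>

lemma (in group) finite_closed_imp_subgroup:
  assumes H: "H \<subseteq> carrier G" "H \<noteq> {}" "finite H"
    and closed: "\<And>x y. x \<in> H \<Longrightarrow> y \<in> H \<Longrightarrow> x \<otimes> y \<in> H"
  shows "subgroup H G"
proof -
  have surj: "(\<lambda>y. x \<otimes> y) ` H = H" if "x \<in> H" for x
  proof (rule endo_inj_surj[OF H(3)])
    show "inj_on (\<lambda>y. x \<otimes> y) H"
      using that H(1) by (intro inj_onI) (metis l_cancel subsetD)
  qed (use that closed in auto)
  obtain a where "a \<in> H" using H(2) by blast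
  then obtain e where e: "e \<in> H" "a \<otimes> e = a"
    using surj[of a] by (metis imageE)
  then have one: "\<one> \<in> H"
    using \<open>a \<in> H\<close> H(1) by (metis r_cancel_one' subsetD l_cancel_one')
  show ?thesis
  proof (rule subgroupI[OF H(1,2) _ closed])
    fix x assume x: "x \<in> H"
    then obtain y where "y \<in> H" "x \<otimes> y = \<one>"
      using surj[OF x] one by (metis imageE)
    then show "inv x \<in> H"
      using x H(1) by (metis inv_equality inv_comm subsetD)
  qed
qed

section \<open>Subsets of a finite abelian group and cosets\<close>

locale finite_comm_group = comm_group +
  assumes finite_carrier: "finite (carrier G)"

lemma subset_monoid_simps:
  "carrier (subset_monoid G) = {A. A \<subseteq> carrier G \<and> A \<noteq> {}}"
  "A \<otimes>\<^bsub>subset_monoid G\<^esub> B = A <#>\<^bsub>G\<^esub> B"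
  "\<one>\<^bsub>subset_monoid G\<^esub> = {\<one>\<^bsub>G\<^esub>}"
  by (simp_all add: subset_monoid_def)

lemma (in comm_group) set_mult_commute:
  "A \<subseteq> carrier G \<Longrightarrow> B \<subseteq> carrier G \<Longrightarrow> A <#> B = B <#> A"
  unfolding set_mult_def using m_comm by blast

lemma (in group) set_mult_mono:
  "A \<subseteq> A' \<Longrightarrow> B \<subseteq> B' \<Longrightarrow> A <#> B \<subseteq> A' <#> B'"
  unfolding set_mult_def by blast

lemma (in comm_group) subset_monoid_comm_monoid: "comm_monoid (subset_monoid G)"
proof (rule comm_monoidI)
  fix A assume "A \<in> carrier (subset_monoid G)"
  then show "\<one>\<^bsub>subset_monoid G\<^esub> \<otimes>\<^bsub>subset_monoid G\<^esub> A = A"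
    by (force simp: subset_monoid_simps set_mult_def)
next
  fix A B assume "A \<in> carrier (subset_monoid G)" "B \<in> carrier (subset_monoid G)"
  then show "A \<otimes>\<^bsub>subset_monoid G\<^esub> B \<in> carrier (subset_monoid G)"
    using set_mult_closed by (auto simp: subset_monoid_simps) (auto simp: set_mult_def)
qed (simp_all add: subset_monoid_simps set_mult_assoc set_mult_commute)

context finite_comm_group
begin

sublocale S: comm_monoid "subset_monoid G"
  by (rule subset_monoid_comm_monoid)

lemma finite_subset_monoid: "finite (carrier (subset_monoid G))"
  using finite_carrier by (auto simp: subset_monoid_simps intro: finite_subset[of _ "Pow (carrier G)"])

text \<open>\<open>idem_power\<close> is a definite description, so existence and uniqueness of the
  idempotent power must be established before anything can be derived about it.\<close>

lemma idem_power_props: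
  assumes A: "A \<in> carrier (subset_monoid G)"
  shows idem_power_eq_power: "\<exists>k::nat\<ge>1. idem_power G A = A [^]\<^bsub>subset_monoid G\<^esub> k"
    and idem_power_idem: "idem_power G A <#> idem_power G A = idem_power G A"
proof -
  obtain k :: nat where k: "k \<ge> 1" and idem: "A [^]\<^bsub>subset_monoid G\<^esub> k \<otimes>\<^bsub>subset_monoid G\<^esub>
      A [^]\<^bsub>subset_monoid G\<^esub> k = A [^]\<^bsub>subset_monoid G\<^esub> k"
    by (rule S.idempotent_power_exists[OF finite_subset_monoid A])
  have "idem_power G A = A [^]\<^bsub>subset_monoid G\<^esub> k"
    unfolding idem_power_def
  proof (rule the_equality)
    fix B assume "B \<in> {A [^]\<^bsub>subset_monoid G\<^esub> k |k::nat. k \<ge> 1} \<and> B <#> B = B"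
    then show "B = A [^]\<^bsub>subset_monoid G\<^esub> k"
      using S.idempotent_power_unique[OF A _ k _ idem] by (auto simp: subset_monoid_simps)
  qed (use k idem in \<open>auto simp: subset_monoid_simps\<close>)
  then show "\<exists>k::nat\<ge>1. idem_power G A = A [^]\<^bsub>subset_monoid G\<^esub> k"
    and "idem_power G A <#> idem_power G A = idem_power G A"
    using k idem by (auto simp: subset_monoid_simps)
qed

lemma idem_power_closed:
  assumes A: "A \<in> carrier (subset_monoid G)"
  shows "idem_power G A \<in> carrier (subset_monoid G)"
  using idem_power_eq_power[OF A] A by auto

text \<open>A nonempty idempotent set is closed under multiplication, which is enough in a finite
  group.\<close>

lemma idem_power_subgroup:
  assumes A: "A \<in> carrier (subset_monoid G)"
  shows "subgroup (idem_power G A) G"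
proof (rule finite_closed_imp_subgroup)
  show "idem_power G A \<subseteq> carrier G" "idem_power G A \<noteq> {}"
    using idem_power_closed[OF A] by (auto simp: subset_monoid_simps)
  then show "finite (idem_power G A)"
    using finite_carrier finite_subset by blast
  fix x y assume "x \<in> idem_power G A" "y \<in> idem_power G A"
  then have "x \<otimes> y \<in> idem_power G A <#> idem_power G A"
    by (auto simp: set_mult_def)
  then show "x \<otimes> y \<in> idem_power G A"
    by (simp add: idem_power_idem[OF A])
qed

text \<open>The product \<open>H <#> A\<close> is the union of the cosets of \<open>H\<close> that
  meet \<open>A\<close>.\<close>

lemma subgroup_set_mult_eq_coset_iff:
  assumes H: "subgroup H G" and A: "A \<in> carrier (subset_monoid G)" and C: "C \<in> rcosets H"
  shows "H <#> A = C \<longleftrightarrow> A \<subseteq> C"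
proof
  interpret H: subgroup H G by (rule H)
  have A': "A \<subseteq> carrier G" "A \<noteq> {}"
    using A by (auto simp: subset_monoid_simps)
  show "A \<subseteq> C" if "H <#> A = C"
  proof
    fix a assume "a \<in> A"
    then have "\<one> \<otimes> a \<in> H <#> A" "\<one> \<otimes> a = a"
      using A'(1) H.one_closed unfolding set_mult_def by auto
    then show "a \<in> C" using that by simp
  qed
  obtain x where x: "x \<in> carrier G" "C = H #> x"
    using C by (auto simp: RCOSETS_def)
  show "H <#> A = C" if AC: "A \<subseteq> C"
  proof
    have "H <#> A \<subseteq> H <#> (H #> x)"
      using AC x(2) by (intro set_mult_mono) auto
    also have "\<dots> = (H <#> H) #> x"
      using x(1) H.subset by (simp add: setmult_rcos_assoc)
    finally show "H <#> A \<subseteq> C"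
      using x(2) subgroup_mult_id[OF H] by simp
    obtain a where a: "a \<in> A" using A'(2) by blast
    then have "C = H #> a"
      using AC x repr_independence[OF _ _ H] by auto
    then show "C \<subseteq> H <#> A"
      using a by (auto simp: r_coset_def set_mult_def)
  qed
qed

text \<open>If some coset of \<open>H\<close> contains \<open>A\<close>, it is
  \<open>H <#> A\<close>, so no representative has to be chosen. \<open>None\<close> marks the sets
  that go to 0.\<close>

definition coset_of :: "'a set \<Rightarrow> 'a set \<Rightarrow> 'a set option" where
  "coset_of H A = (if H <#> A \<in> rcosets H then Some (H <#> A) else None)"

lemma coset_of_eq_Some_iff:
  assumes H: "subgroup H G" and A: "A \<in> carrier (subset_monoid G)"
  shows "coset_of H A = Some C \<longleftrightarrow> C \<in> rcosets H \<and> A \<subseteq> C"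
  using subgroup_set_mult_eq_coset_iff[OF H A] by (auto simp: coset_of_def)

text \<open>The main point is that \<open>A\<close> lies in one coset whenever
  \<open>A <#> B\<close> does: dividing by a fixed element of \<open>B\<close> moves
  \<open>A\<close> into a translate of that coset. Commutativity gives the same for
  \<open>B\<close>.\<close>

lemma coset_of_mult:
  assumes H: "subgroup H G" and A: "A \<in> carrier (subset_monoid G)"
    and B: "B \<in> carrier (subset_monoid G)"
  shows "coset_of H (A <#> B) = (case coset_of H A of None \<Rightarrow> None
    | Some C \<Rightarrow> map_option (\<lambda>D. C <#> D) (coset_of H B))"
proof -
  interpret H: normal H G using H by (rule subgroup_imp_normal)
  have sub: "A \<subseteq> carrier G" "A \<noteq> {}" "B \<subseteq> carrier G" "B \<noteq> {}"
    using A B by (auto simp: subset_monoid_simps)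
  note AB = S.m_closed[OF A B, unfolded subset_monoid_simps(2)]
  have coset_left: "coset_of H A' \<noteq> None"
    if A': "A' \<in> carrier (subset_monoid G)" and B': "B' \<in> carrier (subset_monoid G)"
      and ne: "coset_of H (A' <#> B') \<noteq> None" for A' B'
  proof -
    note AB' = S.m_closed[OF A' B', unfolded subset_monoid_simps(2)]
    obtain x where x: "x \<in> carrier G" "A' <#> B' \<subseteq> H #> x"
      using ne coset_of_eq_Some_iff[OF H AB'] by (auto simp: RCOSETS_def)
    obtain b where b: "b \<in> B'" "b \<in> carrier G"
      using B' by (auto simp: subset_monoid_simps)
    have "a \<in> H #> (x \<otimes> inv b)" if a: "a \<in> A'" for a
    proof -
      have ac: "a \<in> carrier G" using a A' by (auto simp: subset_monoid_simps)
      have "a \<otimes> b \<in> A' <#> B'"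
        using a b by (auto simp: set_mult_def)
      then obtain h where h: "h \<in> H" "a \<otimes> b = h \<otimes> x"
        using x by (auto simp: r_coset_def)
      then have "a = h \<otimes> (x \<otimes> inv b)"
        using ac b x H.mem_carrier by (metis inv_closed inv_solve_right m_assoc m_closed)
      then show ?thesis
        using h by (auto simp: r_coset_def)
    qed
    moreover have "H #> (x \<otimes> inv b) \<in> rcosets H"
      using x b H.subset by (intro rcosetsI) auto
    ultimately show ?thesis
      using coset_of_eq_Some_iff[OF H A'] by blast
  qed
  show ?thesis
  proof (cases "coset_of H A = None \<or> coset_of H B = None")
    case True
    then have "coset_of H (A <#> B) = None"
      using coset_left[OF A B] coset_left[OF B A] set_mult_commute[OF sub(1,3)] by metis
    then show ?thesis
      using True by (auto split: option.split)
  next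
    case False
    then obtain C D where CD: "coset_of H A = Some C" "coset_of H B = Some D"
      by auto
    then have mem: "C \<in> rcosets H" "D \<in> rcosets H" "A \<subseteq> C" "B \<subseteq> D"
      by (simp_all add: coset_of_eq_Some_iff H A B)
    then have "C <#> D \<in> rcosets H"
      by (metis H.setmult_closed)
    then have "coset_of H (A <#> B) = Some (C <#> D)"
      using mem by (simp add: coset_of_eq_Some_iff[OF H AB] set_mult_mono)
    then show ?thesis using CD by simp
  qed
qed

lemma FactGroup_comm_group: "subgroup H G \<Longrightarrow> comm_group (G Mod H)"
  by (rule abelian_FactGroup)

lemma finite_FactGroup: "subgroup H G \<Longrightarrow> finite (carrier (G Mod H))"
  using finite_carrier by (simp add: FactGroup_def RCOSETS_def)

text \<open>The component at \<open>H\<close> of the comparison map, before passing to the quotient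
  by \<open>zero_line G\<close>.\<close>

definition coset_sum :: "'a set \<Rightarrow> ('a set \<Rightarrow> rat) \<Rightarrow> 'a set \<Rightarrow> rat" where
  "coset_sum H = partial_pushforward (subset_monoid G) (coset_of H)"

lemma coset_sum_hom:
  assumes H: "subgroup H G"
  shows "coset_sum H \<in> ring_hom (monoid_algebra (subset_monoid G)) (quotient_group_algebra G H)"
  unfolding coset_sum_def quotient_group_algebra_def
proof (rule partial_pushforward_hom)
  show "comm_monoid (G Mod H)"
    using FactGroup_comm_group[OF H] by (simp add: comm_group_def)
  show "coset_of H \<one>\<^bsub>subset_monoid G\<^esub> = Some \<one>\<^bsub>G Mod H\<^esub>"
  proof -
    have "H \<in> rcosets H"
      by (rule subgroup.subgroup_in_rcosets[OF H is_group])
    then show ?thesis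
      using subgroup.one_closed[OF H] S.one_closed
      by (simp add: coset_of_eq_Some_iff[OF H] subset_monoid_simps FactGroup_def)
  qed
next
  fix A B assume "A \<in> carrier (subset_monoid G)" "B \<in> carrier (subset_monoid G)"
  then show "coset_of H (A \<otimes>\<^bsub>subset_monoid G\<^esub> B) = (case coset_of H A of None \<Rightarrow> None
      | Some C \<Rightarrow> map_option (\<lambda>D. C \<otimes>\<^bsub>G Mod H\<^esub> D) (coset_of H B))"
    using coset_of_mult[OF H, of A B] by (simp add: subset_monoid_simps(2) FactGroup_def split: option.split)
next
  fix A C assume "A \<in> carrier (subset_monoid G)" "coset_of H A = Some C"
  then show "C \<in> carrier (G Mod H)"
    by (simp add: coset_of_eq_Some_iff[OF H] FactGroup_def)
qed (rule S.comm_monoid_axioms finite_subset_monoid finite_FactGroup[OF H])+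

lemma coset_sum_apply:
  assumes H: "subgroup H G"
  shows "coset_sum H f C =
    (\<Sum>A\<in>carrier (subset_monoid G). f A * of_bool (C \<in> rcosets H \<and> A \<subseteq> C))"
  unfolding coset_sum_def partial_pushforward_def
  by (intro sum.cong refl) (simp add: coset_of_eq_Some_iff[OF H])

lemma coset_sum_basis_elem:
  assumes H: "subgroup H G" and A: "A \<in> carrier (subset_monoid G)"
  shows "coset_sum H (basis_elem A) C = of_bool (C \<in> rcosets H \<and> A \<subseteq> C)"
proof -
  have "coset_sum H (basis_elem A) C = (\<Sum>B\<in>carrier (subset_monoid G).
      if B = A then of_bool (C \<in> rcosets H \<and> B \<subseteq> C) else 0)"
    unfolding coset_sum_apply[OF H] by (intro sum.cong) (auto simp: basis_elem_def)
  then show ?thesis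
    using A finite_subset_monoid by simp
qed

text \<open>Write \<open>n(A)\<close> as \<open>B <#> A\<close> with \<open>B\<close> the preceding
  power of \<open>A\<close>. For \<open>c\<close> in \<open>B\<close> both
  \<open>c \<otimes> a\<close> and \<open>c \<otimes> b\<close> lie in the subgroup
  \<open>n(A)\<close>, hence so does \<open>inv a \<otimes> b\<close>.\<close>

lemma subset_l_coset_idem_power:
  assumes A: "A \<in> carrier (subset_monoid G)" and a: "a \<in> A"
  shows "A \<subseteq> a <# idem_power G A"
proof
  fix b assume b: "b \<in> A"
  interpret H: subgroup "idem_power G A" G by (rule idem_power_subgroup[OF A])
  have ab: "a \<in> carrier G" "b \<in> carrier G"
    using A a b by (auto simp: subset_monoid_simps)
  obtain k :: nat where k: "k \<ge> 1" "idem_power G A = A [^]\<^bsub>subset_monoid G\<^esub> k"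
    using idem_power_eq_power[OF A] by blast
  define B where "B = A [^]\<^bsub>subset_monoid G\<^esub> (k - 1)"
  have B: "B \<in> carrier (subset_monoid G)"
    using A by (simp add: B_def)
  have H: "idem_power G A = B <#> A"
    using k by (cases k) (simp_all add: B_def subset_monoid_simps)
  obtain c where c: "c \<in> B" "c \<in> carrier G"
    using B by (auto simp: subset_monoid_simps)
  have "c \<otimes> a \<in> idem_power G A" "c \<otimes> b \<in> idem_power G A"
    unfolding H using a b c by (auto simp: set_mult_def)
  then have "inv (c \<otimes> a) \<otimes> (c \<otimes> b) \<in> idem_power G A"
    by simp
  moreover have "a \<otimes> (inv (c \<otimes> a) \<otimes> (c \<otimes> b)) = b"
    using ab c by (simp add: inv_mult_group m_assoc[symmetric])
  ultimately show "b \<in> a <# idem_power G A"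
    unfolding l_coset_def by force
qed

text \<open>Frees the generators of \<open>coset_ideal\<close> from the choice of
  \<open>g\<close>.\<close>

lemma l_coset_eq_set_mult:
  assumes H: "subgroup H G" and A: "A \<in> carrier (subset_monoid G)" and g: "g \<in> carrier G"
    and sub: "A \<subseteq> g <# H"
  shows "g <# H = A <#> H"
proof -
  interpret H: subgroup H G by (rule H)
  have "g <# H = H #> g"
    using subgroup_imp_normal[OF H] g by (simp add: normal.coset_eq)
  then have "H <#> A = g <# H"
    using g H.subset sub by (subst subgroup_set_mult_eq_coset_iff[OF H A]) (auto intro: rcosetsI)
  then show ?thesis
    using set_mult_commute[of A H] A H.subset by (auto simp: subset_monoid_simps)
qed

text \<open>The coset \<open>g n(A)\<close> of the theorem, written without a representative
  \<open>g\<close>.\<close>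

definition coset_closure :: "'a set \<Rightarrow> 'a set" where
  "coset_closure A = A <#> idem_power G A"

lemma coset_closure_closed:
  "A \<in> carrier (subset_monoid G) \<Longrightarrow> coset_closure A \<in> carrier (subset_monoid G)"
  using S.m_closed[OF _ idem_power_closed] by (simp add: coset_closure_def subset_monoid_simps(2))

lemma coset_closure_in_rcosets:
  assumes A: "A \<in> carrier (subset_monoid G)"
  shows "coset_closure A \<in> rcosets (idem_power G A)"
proof -
  obtain a where a: "a \<in> A" "a \<in> carrier G"
    using A by (auto simp: subset_monoid_simps)
  have "coset_closure A = a <# idem_power G A"
    unfolding coset_closure_def using a
    by (intro l_coset_eq_set_mult[symmetric] idem_power_subgroup A subset_l_coset_idem_power)
  also have "\<dots> = idem_power G A #> a"
    using subgroup_imp_normal[OF idem_power_subgroup[OF A]] a by (simp add: normal.coset_eq)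
  finally show ?thesis
    using a idem_power_closed[OF A] by (auto simp: subset_monoid_simps intro: rcosetsI)
qed

text \<open>If \<open>A\<close> lies in \<open>L #> x\<close>, its powers lie in the cosets
  \<open>L #> (x [^] k)\<close>, so \<open>n(A)\<close> lies in a coset of \<open>L\<close>. As
  \<open>n(A)\<close> contains \<open>\<one>\<close>, that coset is \<open>L\<close>, and
  multiplying by elements of \<open>L\<close> does not leave \<open>C\<close>.\<close>

lemma coset_closure_subset_iff:
  assumes A: "A \<in> carrier (subset_monoid G)" and L: "subgroup L G" and C: "C \<in> rcosets L"
  shows "coset_closure A \<subseteq> C \<longleftrightarrow> A \<subseteq> C"
proof
  interpret L: subgroup L G by (rule L)
  have A': "A \<subseteq> carrier G" using A by (simp add: subset_monoid_simps)
  have one: "\<one> \<in> idem_power G A"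
    using idem_power_subgroup[OF A] by (rule subgroup.one_closed)
  show "A \<subseteq> C" if "coset_closure A \<subseteq> C"
  proof
    fix a assume "a \<in> A"
    then have "a \<otimes> \<one> \<in> coset_closure A" "a \<otimes> \<one> = a"
      using one A' unfolding coset_closure_def set_mult_def by auto
    then show "a \<in> C" using that by auto
  qed
  obtain x where x: "x \<in> carrier G" "C = L #> x"
    using C by (auto simp: RCOSETS_def)
  show "coset_closure A \<subseteq> C" if AC: "A \<subseteq> C"
  proof -
    have "A [^]\<^bsub>subset_monoid G\<^esub> (k::nat) \<subseteq> L #> (x [^] k)" for k
    proof (induction k)
      case 0
      then show ?case using L.one_closed by (simp add: subset_monoid_simps coset_mult_one L.subset)
    next
      case (Suc k)
      have "A [^]\<^bsub>subset_monoid G\<^esub> Suc k \<subseteq> (L #> (x [^] k)) <#> (L #> x)"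
        using Suc AC x(2) by (simp add: subset_monoid_simps set_mult_mono)
      also have "\<dots> = L #> (x [^] Suc k)"
        using subgroup_imp_normal[OF L] x(1) by (simp add: normal.rcos_sum)
      finally show ?case .
    qed
    then obtain k :: nat where k: "idem_power G A \<subseteq> L #> (x [^] k)"
      using idem_power_eq_power[OF A] by metis
    then have "L #> (x [^] k) = L"
      using one repr_independence[OF _ _ L, of \<one> "x [^] k"] x(1) by (simp add: coset_mult_one L.subset subset_iff)
    then have "coset_closure A \<subseteq> C <#> L"
      unfolding coset_closure_def using k AC by (intro set_mult_mono) auto
    also have "\<dots> = C"
      using x L.subset set_mult_commute[of C L] r_coset_subset_G[OF L.subset x(1)] subgroup_mult_id[OF L]
      by (simp add: setmult_rcos_assoc)
    finally show ?thesis .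
  qed
qed

text \<open>Writing \<open>C\<close> as a coset of either subgroup with a common representative
  allows cancelling it. A coset thus determines its subgroup, which keeps the coordinates of the
  different group algebras apart.\<close>

lemma rcosets_inj:
  assumes H: "subgroup H G" and K: "subgroup K G" and C: "C \<in> rcosets H" "C \<in> rcosets K"
  shows "H = K"
proof -
  have sub: "H' \<subseteq> K'" if H': "subgroup H' G" and K': "subgroup K' G" and C': "C \<in> rcosets H'" "C \<in> rcosets K'" for H' K'
  proof
    fix h assume h: "h \<in> H'"
    interpret H': subgroup H' G by (rule H')
    interpret K': subgroup K' G by (rule K')
    obtain x where x: "x \<in> carrier G" "C = H' #> x"
      using C'(1) by (auto simp: RCOSETS_def)
    obtain y where y: "y \<in> carrier G" "C = K' #> y"
      using C'(2) by (auto simp: RCOSETS_def)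
    have "x \<in> C"
      unfolding x(2) by (rule rcos_self[OF x(1) H'])
    then have "K' #> y = K' #> x"
      unfolding y(2) by (rule repr_independence[OF _ y(1) K'])
    moreover have "h \<otimes> x \<in> H' #> x"
      using h by (auto simp: r_coset_def)
    ultimately have "h \<otimes> x \<in> K' #> x"
      using x y by simp
    then obtain k where "k \<in> K'" "h \<otimes> x = k \<otimes> x"
      by (auto simp: r_coset_def)
    then show "h \<in> K'"
      using x h by (metis H'.mem_carrier K'.mem_carrier r_cancel)
  qed
  show ?thesis
    using sub[OF H K C] sub[OF K H C(2) C(1)] by simp
qed

text \<open>The whole group is a coset of itself, hence of no other subgroup. This makes the
  comparison map vanish on \<open>zero_line G\<close>.\<close>

lemma carrier_not_proper_coset:
  "H \<in> proper_subgroups G \<Longrightarrow> carrier G \<notin> rcosets H"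
  using rcosets_inj[of H "carrier G"] subgroup.subgroup_in_rcosets[OF subgroup_self is_group] subgroup_self
  by (auto simp: proper_subgroups_def)

end

section \<open>Triangular systems\<close>

text \<open>By induction the coefficients at proper subsets of \<open>D\<close> vanish, so the
  equation at \<open>D\<close> retains only the term \<open>c D\<close>.\<close>

lemma triangular_unique:
  fixes c :: "'a set \<Rightarrow> 'k::comm_monoid_add"
  assumes fin: "finite F" "\<And>D. D \<in> F \<Longrightarrow> finite D"
    and zero: "\<And>D. D \<in> F \<Longrightarrow> (\<Sum>C | C \<in> F \<and> C \<subseteq> D. c C) = 0"
    and D: "D \<in> F"
  shows "c D = 0"
  using fin(2)[OF D] D
proof (induction D rule: finite_psubset_induct)
  case (psubset D)
  have "(\<Sum>C | C \<in> F \<and> C \<subseteq> D. c C) = (\<Sum>C\<in>{D}. c C)"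
    using psubset fin(1) by (intro sum.mono_neutral_right) auto
  then show ?case
    using zero[OF psubset.prems] by simp
qed

text \<open>Remove a maximal member \<open>M\<close> of \<open>F\<close> and solve the remaining
  system first: \<open>M\<close> enters only its own equation, which then fixes the coefficient at
  \<open>M\<close>.\<close>

lemma triangular_solvable:
  fixes h :: "'a set \<Rightarrow> 'k::ab_group_add"
  assumes "finite F"
  shows "\<exists>c. \<forall>D\<in>F. (\<Sum>C | C \<in> F \<and> C \<subseteq> D. c C) = h D"
  using assms
proof (induction F rule: finite_psubset_induct)
  case (psubset F)
  show ?case
  proof (cases "F = {}")
    case False
    then obtain M where M: "M \<in> F" "\<And>D. D \<in> F \<Longrightarrow> M \<subseteq> D \<Longrightarrow> M = D"
      using finite_has_maximal[OF psubset.hyps] by metis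
    obtain c where c: "\<And>D. D \<in> F - {M} \<Longrightarrow> (\<Sum>C | C \<in> F - {M} \<and> C \<subseteq> D. c C) = h D"
      using psubset.IH[of "F - {M}"] M(1) by blast
    define c' where "c' = c(M := h M - (\<Sum>C | C \<in> F - {M} \<and> C \<subseteq> M. c C))"
    have "(\<Sum>C | C \<in> F \<and> C \<subseteq> D. c' C) = h D" if D: "D \<in> F" for D
    proof (cases "D = M")
      case True
      have "{C. C \<in> F \<and> C \<subseteq> M} = insert M {C. C \<in> F - {M} \<and> C \<subseteq> M}"
        using M(1) by auto
      moreover have "(\<Sum>C | C \<in> F - {M} \<and> C \<subseteq> M. c' C) = (\<Sum>C | C \<in> F - {M} \<and> C \<subseteq> M. c C)"
        by (intro sum.cong) (auto simp: c'_def)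
      ultimately show ?thesis
        using True psubset.hyps by (simp add: c'_def)
    next
      case False
      then have "(\<Sum>C | C \<in> F \<and> C \<subseteq> D. c' C) = (\<Sum>C | C \<in> F - {M} \<and> C \<subseteq> D. c C)"
        using M(2)[OF D] by (intro sum.cong) (auto simp: c'_def)
      then show ?thesis using c[of D] D False by simp
    qed
    then show ?thesis by blast
  qed simp
qed

section \<open>The induced map on the contracted algebra\<close>

text \<open>A homomorphism that vanishes on \<open>I\<close> is constant on cosets, so the image of
  a coset is a singleton, from which \<open>the_elem\<close> reads off the value.\<close>

lemma FactRing_hom_factor:
  assumes R: "ring R" and S: "ring S" and I: "ideal I R" and h: "h \<in> ring_hom R S"
    and zero: "\<And>x. x \<in> I \<Longrightarrow> h x = \<zero>\<^bsub>S\<^esub>"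
  obtains h' where "h' \<in> ring_hom (R Quot I) S" "\<And>x. x \<in> carrier R \<Longrightarrow> h' (I +>\<^bsub>R\<^esub> x) = h x"
proof -
  interpret I: ideal I R by (rule I)
  interpret h: ring_hom_ring R S h by (rule ring_hom_ringI2[OF R S h])
  interpret q: ring_hom_ring R "R Quot I" "(+>\<^bsub>R\<^esub>) I" by (rule I.rcos_ring_hom_ring)
  define h' where "h' C = the_elem (h ` C)" for C
  have h': "h' (I +>\<^bsub>R\<^esub> x) = h x" if x: "x \<in> carrier R" for x
  proof -
    have "h y = h x" if "y \<in> I +>\<^bsub>R\<^esub> x" for y
      using that x zero I.a_Hcarr by (auto simp: a_r_coset_def')
    moreover have "x \<in> I +>\<^bsub>R\<^esub> x"
      by (rule I.a_rcos_self[OF x])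
    ultimately have "h ` (I +>\<^bsub>R\<^esub> x) = {h x}"
      by blast
    then show ?thesis by (simp add: h'_def)
  qed
  have "h' \<in> ring_hom (R Quot I) S"
  proof (rule ring_hom_memI)
    fix C assume "C \<in> carrier (R Quot I)"
    then obtain x where "x \<in> carrier R" "C = I +>\<^bsub>R\<^esub> x" by (rule FactRing_carrierE)
    then show "h' C \<in> carrier S" using h' by simp
  next
    fix C D assume "C \<in> carrier (R Quot I)" "D \<in> carrier (R Quot I)"
    then obtain x y where xy: "x \<in> carrier R" "C = I +>\<^bsub>R\<^esub> x" "y \<in> carrier R" "D = I +>\<^bsub>R\<^esub> y"
      by (metis FactRing_carrierE)
    show "h' (C \<otimes>\<^bsub>R Quot I\<^esub> D) = h' C \<otimes>\<^bsub>S\<^esub> h' D"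
      using xy h' by (simp flip: q.hom_mult)
    show "h' (C \<oplus>\<^bsub>R Quot I\<^esub> D) = h' C \<oplus>\<^bsub>S\<^esub> h' D"
      using xy h' by (simp flip: q.hom_add)
  next
    show "h' \<one>\<^bsub>R Quot I\<^esub> = \<one>\<^bsub>S\<^esub>"
      using h'[of "\<one>\<^bsub>R\<^esub>"] by (simp flip: q.hom_one)
  qed
  then show thesis using h' that by blast
qed

lemma (in cring) finprod_zeroI:
  assumes "finite A" "f \<in> A \<rightarrow> carrier R" "x \<in> A" "f x = \<zero>"
  shows "finprod R f A = \<zero>"
proof -
  have "finprod R f (insert x (A - {x})) = \<zero>"
    using assms by (subst finprod_insert) (auto intro!: l_null finprod_closed)
  then show ?thesis using assms(3) by (simp add: insert_absorb)
qed

lemma (in group) exists_min_nontrivial_subgroup: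
  assumes fin: "finite (carrier G)" and N: "subgroup N G" "N \<noteq> {\<one>}"
  obtains K where "K \<in> min_nontrivial_subgroups G" "K \<subseteq> N"
proof -
  have "finite {L. subgroup L G \<and> L \<noteq> {\<one>}}"
    using fin by (auto intro!: finite_subset[of _ "Pow (carrier G)"] dest: subgroup.subset)
  then obtain K where K: "K \<in> {L. subgroup L G \<and> L \<noteq> {\<one>}}" "K \<subseteq> N"
    and min: "\<forall>L\<in>{L. subgroup L G \<and> L \<noteq> {\<one>}}. L \<subseteq> K \<longrightarrow> K = L"
    using finite_has_minimal2[of "{L. subgroup L G \<and> L \<noteq> {\<one>}}" N] N by auto
  then have "K \<in> min_nontrivial_subgroups G"
    unfolding min_nontrivial_subgroups_def by auto
  then show thesis using K(2) that by blast
qed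

section \<open>Subgroups minimal over a given subgroup\<close>

context finite_comm_group
begin

text \<open>The preimage is finite and closed under products. A coset in \<open>K\<close> other than
  \<open>H\<close> supplies an element outside \<open>H\<close>, so the inclusion is strict.\<close>

lemma quotient_preimage_min_nontrivial:
  assumes H: "subgroup H G" and K: "K \<in> min_nontrivial_subgroups (G Mod H)"
  shows "subgroup (quotient_preimage G H K) G" "H \<subset> quotient_preimage G H K"
proof -
  interpret H: normal H G using H by (rule subgroup_imp_normal)
  have K': "subgroup K (G Mod H)" "K \<noteq> {H}"
    using K by (auto simp: min_nontrivial_subgroups_def FactGroup_def)
  interpret K: subgroup K "G Mod H" by (rule K'(1))
  have HK: "H \<in> K"
    using K.one_closed by (simp add: FactGroup_def)
  have sub: "H \<subseteq> quotient_preimage G H K"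
    using HK H.rcos_const by (auto simp: quotient_preimage_def H.mem_carrier)
  show "subgroup (quotient_preimage G H K) G"
  proof (rule finite_closed_imp_subgroup)
    show "quotient_preimage G H K \<subseteq> carrier G"
      by (auto simp: quotient_preimage_def)
    then show "finite (quotient_preimage G H K)"
      using finite_carrier finite_subset by blast
    show "quotient_preimage G H K \<noteq> {}"
      using sub H.one_closed by blast
    fix x y assume "x \<in> quotient_preimage G H K" "y \<in> quotient_preimage G H K"
    then show "x \<otimes> y \<in> quotient_preimage G H K"
      using K.m_closed[of "H #> x" "H #> y"] by (simp add: quotient_preimage_def H.rcos_sum)
  qed
  obtain C where C: "C \<in> K" "C \<noteq> H"
    using K' HK by blast
  then obtain x where x: "x \<in> carrier G" "C = H #> x"
    using K.subset by (auto simp: FactGroup_def RCOSETS_def)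
  then have "x \<in> quotient_preimage G H K" "x \<notin> H"
    using C H.rcos_const by (auto simp: quotient_preimage_def)
  then show "H \<subset> quotient_preimage G H K"
    using sub by blast
qed

text \<open>The image of \<open>L\<close> in \<open>G Mod H\<close> is nontrivial, so it contains a
  minimal nontrivial subgroup; because \<open>H\<close> lies in \<open>L\<close>, the preimage stays
  inside \<open>L\<close>.\<close>

lemma exists_min_nontrivial_preimage_below:
  assumes H: "subgroup H G" and L: "subgroup L G" and HL: "H \<subset> L"
  obtains K where "K \<in> min_nontrivial_subgroups (G Mod H)" "quotient_preimage G H K \<subseteq> L"
proof -
  interpret H: normal H G using H by (rule subgroup_imp_normal)
  interpret L: subgroup L G by (rule L)
  interpret Q: comm_group "G Mod H" by (rule FactGroup_comm_group[OF H])
  let ?N = "(\<lambda>x. H #> x) ` L"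
  have "subgroup ?N (G Mod H)"
  proof (rule Q.finite_closed_imp_subgroup)
    show sub: "?N \<subseteq> carrier (G Mod H)"
      using L.subset H.subset by (auto simp: FactGroup_def intro: rcosetsI)
    show "?N \<noteq> {}"
      using L.one_closed by blast
    show "finite ?N"
      using finite_subset[OF L.subset finite_carrier] by simp
    fix C D assume "C \<in> ?N" "D \<in> ?N"
    then show "C \<otimes>\<^bsub>G Mod H\<^esub> D \<in> ?N"
      by (auto simp: H.rcos_sum)
  qed
  moreover have "?N \<noteq> {\<one>\<^bsub>G Mod H\<^esub>}"
  proof
    assume eq: "?N = {\<one>\<^bsub>G Mod H\<^esub>}"
    obtain x where x: "x \<in> L" "x \<notin> H" using HL by blast
    then have "H #> x = H"
      using eq by (auto simp: FactGroup_def)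
    then show False
      using x rcos_self[OF L.mem_carrier H, of x] by auto
  qed
  ultimately obtain K where K: "K \<in> min_nontrivial_subgroups (G Mod H)" "K \<subseteq> ?N"
    using Q.exists_min_nontrivial_subgroup[OF finite_FactGroup[OF H]] by metis
  have "quotient_preimage G H K \<subseteq> L"
  proof
    fix x assume x: "x \<in> quotient_preimage G H K"
    then obtain y where y: "y \<in> L" "H #> x = H #> y"
      using K(2) by (auto simp: quotient_preimage_def)
    have xc: "x \<in> carrier G"
      using x by (simp add: quotient_preimage_def)
    then have "x \<in> H #> y"
      using rcos_self[OF xc H] y(2) by simp
    then show "x \<in> L"
      using HL y(1) by (auto simp: r_coset_def)
  qed
  then show thesis using K(1) that by blast
qed

section \<open>The contracted algebra and its coset ideal\<close>

sublocale R: cring "monoid_algebra (subset_monoid G) :: ('a set \<Rightarrow> rat) ring"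
  by (rule S.monoid_algebra_cring[OF finite_subset_monoid])

lemma carrier_in_subset_monoid: "carrier G \<in> carrier (subset_monoid G)"
  by (auto simp: subset_monoid_simps)

text \<open>The line is the principal ideal of the basis element at \<open>carrier G\<close>: the
  whole group absorbs every subset, so multiplication by \<open>f\<close> scales that element by the
  sum of the coefficients of \<open>f\<close>.\<close>

lemma zero_line_ideal: "ideal (zero_line G) (monoid_algebra (subset_monoid G))"
proof -
  note carrier_R = carrier_monoid_algebra[OF finite_subset_monoid]
  let ?g = "basis_elem (carrier G) :: 'a set \<Rightarrow> rat"
  have g: "?g \<in> carrier (monoid_algebra (subset_monoid G))"
    by (rule basis_elem_closed[OF carrier_in_subset_monoid])
  have absorb: "A <#> carrier G = carrier G" if A: "A \<in> carrier (subset_monoid G)" for A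
  proof -
    have "A <#> carrier G = carrier G <#> A"
      using A by (intro set_mult_commute) (auto simp: subset_monoid_simps)
    also have "\<dots> = carrier G"
      using A subgroup.subgroup_in_rcosets[OF subgroup_self is_group]
      by (subst subgroup_set_mult_eq_coset_iff[OF subgroup_self A]) (auto simp: subset_monoid_simps)
    finally show ?thesis .
  qed
  have mult: "f \<otimes>\<^bsub>monoid_algebra (subset_monoid G)\<^esub> ?g =
      (\<lambda>B. (\<Sum>A\<in>carrier (subset_monoid G). f A) * ?g B)"
    if f: "f \<in> carrier (monoid_algebra (subset_monoid G))" for f
  proof
    fix B
    have "(f \<otimes>\<^bsub>monoid_algebra (subset_monoid G)\<^esub> ?g) B =
        (\<Sum>A\<in>carrier (subset_monoid G). \<Sum>C\<in>carrier (subset_monoid G).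
          if C = carrier G then f A * of_bool (A <#> C = B) else 0)"
      unfolding monoid_algebra_mult_apply[OF finite_subset_monoid f g]
      by (intro sum.cong refl) (auto simp: basis_elem_def subset_monoid_simps(2))
    also have "\<dots> = (\<Sum>A\<in>carrier (subset_monoid G). f A * of_bool (carrier G = B))"
      using finite_subset_monoid carrier_in_subset_monoid by (simp add: absorb)
    finally show "(f \<otimes>\<^bsub>monoid_algebra (subset_monoid G)\<^esub> ?g) B =
        (\<Sum>A\<in>carrier (subset_monoid G). f A) * ?g B"
      by (auto simp: basis_elem_def sum_distrib_right)
  qed
  have "zero_line G = PIdl\<^bsub>monoid_algebra (subset_monoid G)\<^esub> ?g"
  proof
    show "zero_line G \<subseteq> PIdl\<^bsub>monoid_algebra (subset_monoid G)\<^esub> ?g"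
    proof
      fix f assume "f \<in> zero_line G"
      then obtain c where "f = (\<lambda>B. c * ?g B)" by (auto simp: zero_line_def)
      also have "\<dots> = (\<lambda>B. c * basis_elem \<one>\<^bsub>subset_monoid G\<^esub> B) \<otimes>\<^bsub>monoid_algebra (subset_monoid G)\<^esub> ?g"
        by (rule S.monoid_algebra_scale[OF finite_subset_monoid g])
      finally show "f \<in> PIdl\<^bsub>monoid_algebra (subset_monoid G)\<^esub> ?g"
        using basis_elem_closed[OF S.one_closed, where 'k = rat]
        by (auto simp: cgenideal_def carrier_R)
    qed
    show "PIdl\<^bsub>monoid_algebra (subset_monoid G)\<^esub> ?g \<subseteq> zero_line G"
      by (auto simp: cgenideal_def zero_line_def mult)
  qed
  then show ?thesis
    using R.cgenideal_ideal[OF g] by simp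
qed

sublocale Z: ideal "zero_line G" "monoid_algebra (subset_monoid G) :: ('a set \<Rightarrow> rat) ring"
  by (rule zero_line_ideal)

lemma char_algebra_cring: "cring (char_algebra G)"
  unfolding char_algebra_def by (rule Z.quotient_is_cring[OF R.is_cring])

lemma char_algebra_proj_hom:
  "ring_hom_cring (monoid_algebra (subset_monoid G)) (char_algebra G)
    ((+>\<^bsub>monoid_algebra (subset_monoid G)\<^esub>) (zero_line G))"
  unfolding char_algebra_def by (rule Z.rcos_ring_hom_cring[OF R.is_cring])

sublocale Q: cring "char_algebra G"
  by (rule char_algebra_cring)

sublocale proj: ring_hom_cring "monoid_algebra (subset_monoid G)" "char_algebra G"
    "(+>\<^bsub>monoid_algebra (subset_monoid G)\<^esub>) (zero_line G)"
  by (rule char_algebra_proj_hom)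

lemma chi_closed: "A \<in> carrier (subset_monoid G) \<Longrightarrow> chi G A \<in> carrier (char_algebra G)"
  unfolding chi_def by (rule proj.hom_closed[OF basis_elem_closed])

lemma chi_mult:
  "A \<in> carrier (subset_monoid G) \<Longrightarrow> B \<in> carrier (subset_monoid G) \<Longrightarrow>
    chi G A \<otimes>\<^bsub>char_algebra G\<^esub> chi G B = chi G (A <#> B)"
  unfolding chi_def
  by (simp add: basis_elem_closed S.basis_elem_mult finite_subset_monoid subset_monoid_simps(2)
      flip: proj.hom_mult)

lemma chi_pow:
  "A \<in> carrier (subset_monoid G) \<Longrightarrow>
    chi G A [^]\<^bsub>char_algebra G\<^esub> (k::nat) = chi G (A [^]\<^bsub>subset_monoid G\<^esub> k)"
proof (induction k)
  case 0
  then show ?case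
    unfolding chi_def using proj.hom_one by (simp add: monoid_algebra_simps)
next
  case (Suc k)
  then show ?case by (simp add: chi_mult flip: subset_monoid_simps(2))
qed

text \<open>An instance of the nilpotency of \<open>ae - a\<close>, with \<open>a\<close> the class
  of \<open>A\<close> and \<open>e\<close> the idempotent class of \<open>n(A)\<close>, which is a
  power of \<open>a\<close>.\<close>

lemma chi_coset_diff_nilpotent:
  assumes A: "A \<in> carrier (subset_monoid G)"
  obtains k :: nat where "(chi G (coset_closure A) \<ominus>\<^bsub>char_algebra G\<^esub> chi G A) [^]\<^bsub>char_algebra G\<^esub> k =
    \<zero>\<^bsub>char_algebra G\<^esub>"
proof -
  note H = idem_power_closed[OF A]
  obtain k :: nat where k: "k \<ge> 1" "idem_power G A = A [^]\<^bsub>subset_monoid G\<^esub> k"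
    using idem_power_eq_power[OF A] by blast
  have "(chi G A \<otimes>\<^bsub>char_algebra G\<^esub> chi G (idem_power G A) \<ominus>\<^bsub>char_algebra G\<^esub> chi G A)
      [^]\<^bsub>char_algebra G\<^esub> k = \<zero>\<^bsub>char_algebra G\<^esub>"
    using A H k idem_power_idem[OF A]
    by (intro Q.idempotent_power_nilpotent) (simp_all add: chi_closed chi_mult chi_pow)
  then show thesis
    using that by (simp add: chi_mult A H coset_closure_def)
qed

text \<open>All admissible \<open>g\<close> give the same coset, and every element of
  \<open>A\<close> is admissible.\<close>

lemma coset_ideal_eq:
  "coset_ideal G = Idl\<^bsub>char_algebra G\<^esub>
    {chi G (coset_closure A) \<ominus>\<^bsub>char_algebra G\<^esub> chi G A | A. A \<in> carrier (subset_monoid G)}"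
proof -
  have "{chi G (g <# idem_power G A) \<ominus>\<^bsub>char_algebra G\<^esub> chi G A | A g.
      A \<subseteq> carrier G \<and> A \<noteq> {} \<and> g \<in> carrier G \<and> A \<subseteq> g <# idem_power G A} =
    {chi G (coset_closure A) \<ominus>\<^bsub>char_algebra G\<^esub> chi G A | A. A \<in> carrier (subset_monoid G)}"
    (is "?S = ?T")
  proof
    show "?S \<subseteq> ?T"
    proof
      fix x assume "x \<in> ?S"
      then obtain A g where x: "x = chi G (g <# idem_power G A) \<ominus>\<^bsub>char_algebra G\<^esub> chi G A"
        and A: "A \<in> carrier (subset_monoid G)" and g: "g \<in> carrier G" "A \<subseteq> g <# idem_power G A"
        by (auto simp: subset_monoid_simps)
      then show "x \<in> ?T"
        using l_coset_eq_set_mult[OF idem_power_subgroup[OF A] A g] by (auto simp: coset_closure_def)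
    qed
    show "?T \<subseteq> ?S"
    proof
      fix x assume "x \<in> ?T"
      then obtain A where x: "x = chi G (coset_closure A) \<ominus>\<^bsub>char_algebra G\<^esub> chi G A"
        and A: "A \<in> carrier (subset_monoid G)"
        by blast
      obtain a where a: "a \<in> A" "a \<in> carrier G"
        using A by (auto simp: subset_monoid_simps)
      have sub: "A \<subseteq> a <# idem_power G A"
        by (rule subset_l_coset_idem_power[OF A a(1)])
      then have "coset_closure A = a <# idem_power G A"
        using l_coset_eq_set_mult[OF idem_power_subgroup[OF A] A a(2)] by (simp add: coset_closure_def)
      then show "x \<in> ?S"
        by (intro CollectI exI[of _ A] exI[of _ a])
          (use x A a(2) sub in \<open>simp_all add: subset_monoid_simps\<close>)
    qed
  qed
  then show ?thesis by (simp add: coset_ideal_def)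
qed

lemma coset_sum_scaled_carrier:
  assumes H: "H \<in> proper_subgroups G"
  shows "coset_sum H (\<lambda>B. c * basis_elem (carrier G) B) = (\<lambda>C. 0)"
proof
  fix C
  have H': "subgroup H G" using H by (simp add: proper_subgroups_def)
  have "C \<noteq> carrier G" if "C \<in> rcosets H"
    using that carrier_not_proper_coset[OF H] by auto
  moreover have "C \<subseteq> carrier G" if "C \<in> rcosets H"
    by (rule subgroup.rcosets_carrier[OF H' is_group that])
  ultimately show "coset_sum H (\<lambda>B. c * basis_elem (carrier G) B) C = 0"
    unfolding coset_sum_apply[OF H'] by (intro sum.neutral) (auto simp: basis_elem_def)
qed

text \<open>Modulo \<open>N\<close>, replacing each \<open>A\<close> by the coset \<open>gH\<close> containing it turns \<open>f\<close> into a combination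
  of cosets, and the coset sums then form a triangular system for its coefficients.\<close>

lemma coset_sums_zero_imp_mem:
  assumes N: "ideal N (monoid_algebra (subset_monoid G))" and line: "zero_line G \<subseteq> N"
    and gen: "\<And>A. A \<in> carrier (subset_monoid G) \<Longrightarrow> (\<lambda>B. basis_elem (coset_closure A) B - basis_elem A B) \<in> N"
    and f: "f \<in> carrier (monoid_algebra (subset_monoid G))"
    and zero: "\<And>H. H \<in> proper_subgroups G \<Longrightarrow> coset_sum H f = (\<lambda>C. 0)"
  shows "f \<in> N"
proof -
  let ?S = "carrier (subset_monoid G)"
  interpret N: ideal N "monoid_algebra (subset_monoid G)" by (rule N)
  note carrier_R = carrier_monoid_algebra[OF finite_subset_monoid]
  note fin = finite_subset_monoid
  have add: "(\<lambda>B. v B + w B) \<in> N" if "v \<in> N" "w \<in> N" for v w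
    using N.a_closed[OF that] by (simp add: monoid_algebra_simps)
  have scale: "(\<lambda>B. c * v B) \<in> N" if v: "v \<in> N" for c v
  proof -
    have "(\<lambda>B. c * basis_elem \<one>\<^bsub>subset_monoid G\<^esub> B) \<in> carrier (monoid_algebra (subset_monoid G))"
      using basis_elem_closed[OF S.one_closed, where 'k = rat] by (simp add: carrier_R)
    then show ?thesis
      using S.monoid_algebra_scale[OF fin N.a_Hcarr[OF v], of c] N.I_l_closed[OF v] by simp
  qed
  define f' where "f' B = (\<Sum>A\<in>?S. f A * basis_elem (coset_closure A) B)" for B
  \<comment> \<open>With the coefficients \<open>- f A\<close> this combination is
    \<open>f - f'\<close>, once \<open>f\<close> is expanded in the basis.\<close>
  have "(\<lambda>B. \<Sum>A\<in>?S. (- f A) * (basis_elem (coset_closure A) B - basis_elem A B)) \<in> N"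
    using N.zero_closed
    by (intro subspace_sum_scaled add scale gen) (simp_all add: monoid_algebra_simps)
  moreover have "(\<Sum>A\<in>?S. f A * basis_elem A B) = f B" for B
  proof -
    have "(\<Sum>A\<in>?S. f A * basis_elem A B) = (\<Sum>A\<in>?S. if A = B then f A else 0)"
      by (intro sum.cong) (auto simp: basis_elem_def)
    then show ?thesis using f fin by (simp add: carrier_R)
  qed
  ultimately have diff: "(\<lambda>B. f B - f' B) \<in> N"
    by (simp add: f'_def algebra_simps sum_subtractf sum_negf sum.distrib)
  \<comment> \<open>Only cosets of proper subgroups are collected; the remaining coset
    \<open>carrier G\<close> is absorbed by \<open>zero_line G\<close>.\<close>
  define F where "F = (\<Union>H\<in>proper_subgroups G. rcosets H)"
  have F_S: "F \<subseteq> ?S"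
  proof
    fix C assume "C \<in> F"
    then obtain H x where H: "subgroup H G" and x: "x \<in> carrier G" "C = H #> x"
      by (auto simp: F_def proper_subgroups_def RCOSETS_def)
    then show "C \<in> ?S"
      using rcos_self[OF x(1) H] r_coset_subset_G[OF subgroup.subset[OF H] x(1)]
      by (auto simp: subset_monoid_simps)
  qed
  have supp: "f' B = 0" if B: "B \<notin> F" "B \<noteq> carrier G" for B
  proof -
    have "coset_closure A \<noteq> B" if A: "A \<in> ?S" for A
    proof
      assume eq: "coset_closure A = B"
      then have mem: "B \<in> rcosets (idem_power G A)"
        using coset_closure_in_rcosets[OF A] by simp
      then have "idem_power G A = carrier G"
        using B(1) idem_power_subgroup[OF A] by (auto simp: F_def proper_subgroups_def)
      then obtain x where "x \<in> carrier G" "B = carrier G #> x"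
        using mem by (auto simp: RCOSETS_def)
      then show False
        using B(2) coset_join2[OF _ subgroup_self] by simp
    qed
    then show ?thesis
      unfolding f'_def by (intro sum.neutral) (auto simp: basis_elem_def)
  qed
  have "f' D = 0" if "D \<in> F" for D
  proof (rule triangular_unique[OF _ _ _ that])
    show "finite F"
      using F_S fin by (rule finite_subset)
    show "finite D" if "D \<in> F" for D
      using that F_S finite_subset[OF _ finite_carrier] by (auto simp: subset_monoid_simps)
    show "(\<Sum>C | C \<in> F \<and> C \<subseteq> D. f' C) = 0" if DF: "D \<in> F" for D
    proof -
      obtain H where H: "H \<in> proper_subgroups G" and D: "D \<in> rcosets H"
        using DF by (auto simp: F_def)
      have H': "subgroup H G" using H by (simp add: proper_subgroups_def)
      \<comment> \<open>This discards the term at \<open>carrier G\<close>, the only set outside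
        \<open>F\<close> where \<open>f'\<close> may be nonzero.\<close>
      have "D \<noteq> carrier G"
        using D carrier_not_proper_coset[OF H] by metis
      then have DG: "\<not> carrier G \<subseteq> D"
        using subgroup.rcosets_carrier[OF H' is_group D] by (metis subset_antisym)
      have "(\<Sum>C | C \<in> F \<and> C \<subseteq> D. f' C) = (\<Sum>C\<in>?S. f' C * of_bool (C \<subseteq> D))"
        using fin F_S DG supp by (intro sum.mono_neutral_cong_left) auto
      also have "\<dots> = (\<Sum>A\<in>?S. f A * (\<Sum>C\<in>?S. if C = coset_closure A then of_bool (C \<subseteq> D) else 0))"
        unfolding f'_def sum_distrib_right
        by (subst sum.swap) (auto simp: sum_distrib_left basis_elem_def intro!: sum.cong)
      \<comment> \<open>A set and its closure lie in the same cosets of \<open>H\<close>, so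
        \<open>f'\<close> inherits the coset sums of \<open>f\<close>.\<close>
      also have "\<dots> = (\<Sum>A\<in>?S. f A * of_bool (D \<in> rcosets H \<and> A \<subseteq> D))"
        using fin D coset_closure_subset_iff[OF _ H' D] by (intro sum.cong) (simp_all add: coset_closure_closed)
      also have "\<dots> = 0"
        using zero[OF H] by (simp flip: coset_sum_apply[OF H'])
      finally show ?thesis .
    qed
  qed
  then have "f' = (\<lambda>B. f' (carrier G) * basis_elem (carrier G) B)"
    using supp by (auto simp: basis_elem_def fun_eq_iff)
  then have "f' \<in> N"
    using line unfolding zero_line_def by blast
  then show ?thesis
    using add[OF diff, of f'] by simp
qed

section \<open>The map to the product of the group algebras\<close>

lemma quotient_group_algebra_cring: "subgroup H G \<Longrightarrow> cring (quotient_group_algebra G H)"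
  unfolding quotient_group_algebra_def
  using comm_monoid.monoid_algebra_cring[OF _ finite_FactGroup] FactGroup_comm_group
  by (simp add: comm_group_def)

lemma quotient_group_algebra_carrier:
  "subgroup H G \<Longrightarrow>
    f \<in> carrier (quotient_group_algebra G H) \<longleftrightarrow> (\<forall>C. C \<notin> rcosets H \<longrightarrow> f C = 0)"
  using carrier_monoid_algebra[OF finite_FactGroup]
  by (simp add: quotient_group_algebra_def FactGroup_def)

definition coset_sums :: "('a set \<Rightarrow> rat) \<Rightarrow> 'a set \<Rightarrow> ('a set \<Rightarrow> rat)" where
  "coset_sums f = (\<lambda>H\<in>proper_subgroups G. coset_sum H f)"

lemma coset_sums_hom:
  "coset_sums \<in> ring_hom (monoid_algebra (subset_monoid G))
    (product_ring (proper_subgroups G) (quotient_group_algebra G))"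
  unfolding coset_sums_def
  by (rule product_ring_tuple_hom) (simp add: coset_sum_hom proper_subgroups_def)

text \<open>It suffices to use coefficients on cosets of proper subgroups. The value required at
  \<open>D\<close> is taken from the component of the unique \<open>H\<close> that has
  \<open>D\<close> as a coset, and inclusion makes the system triangular.\<close>

lemma coset_sums_surj:
  assumes b: "b \<in> carrier (product_ring (proper_subgroups G) (quotient_group_algebra G))"
  obtains f where "f \<in> carrier (monoid_algebra (subset_monoid G))" "coset_sums f = b"
proof -
  let ?S = "carrier (subset_monoid G)"
  define F where "F = {C \<in> ?S. \<exists>H\<in>proper_subgroups G. C \<in> rcosets H}"
  have "finite F"
    using finite_subset_monoid by (simp add: F_def)
  then obtain c where c: "\<And>D. D \<in> F \<Longrightarrow>
      (\<Sum>C | C \<in> F \<and> C \<subseteq> D. c C) = b (THE H. H \<in> proper_subgroups G \<and> D \<in> rcosets H) D"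
    using triangular_solvable[of F "\<lambda>D. b (THE H. H \<in> proper_subgroups G \<and> D \<in> rcosets H) D"] by blast
  define f where "f = (\<lambda>A. if A \<in> F then c A else 0)"
  have "coset_sum H f = b H" if H: "H \<in> proper_subgroups G" for H
  proof
    fix D
    have H': "subgroup H G" using H by (simp add: proper_subgroups_def)
    show "coset_sum H f D = b H D"
    proof (cases "D \<in> rcosets H")
      case False
      then show ?thesis
        using b H by (auto simp: coset_sum_apply[OF H'] product_ring_simps PiE_iff
            quotient_group_algebra_carrier[OF H'])
    next
      case D: True
      have "D \<in> ?S"
        using subgroup.rcosets_carrier[OF H' is_group D] subgroup.rcosets_non_empty[OF H' D]
        by (simp add: subset_monoid_simps)
      then have "D \<in> F"
        using D H by (auto simp: F_def)
      have "coset_sum H f D = (\<Sum>C | C \<in> F \<and> C \<subseteq> D. c C)"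
        unfolding coset_sum_apply[OF H'] using finite_subset_monoid D
        by (intro sum.mono_neutral_cong_right) (auto simp: f_def F_def)
      also have "\<dots> = b (THE H. H \<in> proper_subgroups G \<and> D \<in> rcosets H) D"
        by (rule c[OF \<open>D \<in> F\<close>])
      also have "(THE H. H \<in> proper_subgroups G \<and> D \<in> rcosets H) = H"
        using H D rcosets_inj by (intro the_equality) (auto simp: proper_subgroups_def)
      finally show ?thesis .
    qed
  qed
  then have "b = coset_sums f"
    by (intro product_ring_eqI[OF b]) (simp_all add: coset_sums_def)
  moreover have "f \<in> carrier (monoid_algebra (subset_monoid G))"
    by (simp add: carrier_monoid_algebra[OF finite_subset_monoid] f_def F_def)
  ultimately show thesis using that by simp
qed

lemma subgroup_in_subset_monoid: "subgroup H G \<Longrightarrow> H \<in> carrier (subset_monoid G)"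
  using subgroup.subset subgroup.one_closed by (fastforce simp: subset_monoid_simps)

text \<open>The only coset of \<open>L\<close> that can contain \<open>H\<close> is \<open>L\<close>
  itself, since both contain \<open>\<one>\<close> and distinct cosets are disjoint.\<close>

lemma coset_sum_subgroup:
  assumes H: "subgroup H G" and L: "subgroup L G"
  shows "coset_sum L (basis_elem H) =
    (if H \<subseteq> L then \<one>\<^bsub>quotient_group_algebra G L\<^esub> else \<zero>\<^bsub>quotient_group_algebra G L\<^esub>)"
proof
  fix C
  note HS = subgroup_in_subset_monoid[OF H]
  have own: "L \<in> rcosets L"
    by (rule subgroup.subgroup_in_rcosets[OF L is_group])
  have "C = L" if "C \<in> rcosets L" "H \<subseteq> C"
    using that own subgroup.one_closed[OF H] subgroup.one_closed[OF L]
      rcos_disjoint[OF L] unfolding pairwise_def disjnt_iff by blast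
  then show "coset_sum L (basis_elem H) C =
    (if H \<subseteq> L then \<one>\<^bsub>quotient_group_algebra G L\<^esub> else \<zero>\<^bsub>quotient_group_algebra G L\<^esub>) C"
    using own unfolding coset_sum_basis_elem[OF L HS] quotient_group_algebra_def monoid_algebra_simps
    by (auto simp: basis_elem_def FactGroup_def)
qed

end

section \<open>Assembling the isomorphism and locating the unit elements\<close>

theorem theorem5p10:
  fixes G :: "('a, 'b) monoid_scheme"
  assumes "comm_group G" and "finite (carrier G)"
  shows "jacobson_radical (char_algebra G) = coset_ideal G \<and>
    (\<exists>\<phi> \<in> ring_iso (product_ring (proper_subgroups G) (quotient_group_algebra G))
                   (char_algebra G Quot jacobson_radical (char_algebra G)).
       \<forall>H \<in> proper_subgroups G.
         \<phi> (summand_inj (proper_subgroups G) (quotient_group_algebra G) H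
              \<one>\<^bsub>quotient_group_algebra G H\<^esub>) =
         jacobson_radical (char_algebra G) +>\<^bsub>char_algebra G\<^esub>
           (\<Otimes>\<^bsub>char_algebra G\<^esub>K \<in> min_nontrivial_subgroups (G Mod H).
              chi G H \<ominus>\<^bsub>char_algebra G\<^esub> chi G (quotient_preimage G H K)))"
proof -
  interpret finite_comm_group G
    using assms by (simp add: finite_comm_group_def finite_comm_group_axioms_def)
  let ?R = "monoid_algebra (subset_monoid G) :: ('a set \<Rightarrow> rat) ring"
  let ?Q = "char_algebra G"
  let ?P = "product_ring (proper_subgroups G) (quotient_group_algebra G)"
  let ?J = "jacobson_radical ?Q"
  have subgroup: "subgroup H G" if "H \<in> proper_subgroups G" for H
    using that by (simp add: proper_subgroups_def)
  interpret P: cring ?P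
    by (intro product_ring_cring quotient_group_algebra_cring subgroup)
  \<comment> \<open>The tuple of coset sums vanishes on \<open>zero_line G\<close>, so it descends
    to the contracted algebra.\<close>
  obtain \<psi> where \<psi>: "\<psi> \<in> ring_hom ?Q ?P"
    and \<psi>_proj: "\<And>f. f \<in> carrier ?R \<Longrightarrow> \<psi> (zero_line G +>\<^bsub>?R\<^esub> f) = coset_sums f"
  proof (rule FactRing_hom_factor[OF R.ring_axioms P.ring_axioms zero_line_ideal coset_sums_hom])
    show "coset_sums f = \<zero>\<^bsub>?P\<^esub>" if "f \<in> zero_line G" for f
      using that coset_sum_scaled_carrier
      by (auto simp: zero_line_def coset_sums_def product_ring_simps quotient_group_algebra_def
          monoid_algebra_simps intro!: restrict_ext)
  qed (simp add: char_algebra_def)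
  interpret \<psi>: ring_hom_cring ?Q ?P \<psi>
    by (intro ring_hom_cring.intro ring_hom_cring_axioms.intro Q.is_cring P.is_cring \<psi>)
  let ?ker = "a_kernel ?Q ?P \<psi>"
  have ker_iff: "x \<in> ?ker \<longleftrightarrow> x \<in> carrier ?Q \<and> \<psi> x = \<zero>\<^bsub>?P\<^esub>" for x
    unfolding a_kernel_def' by blast
  have surj: "\<psi> ` carrier ?Q = carrier ?P"
  proof
    show "carrier ?P \<subseteq> \<psi> ` carrier ?Q"
    proof
      fix b assume "b \<in> carrier ?P"
      then obtain f where f: "f \<in> carrier ?R" "coset_sums f = b"
        by (rule coset_sums_surj)
      then show "b \<in> \<psi> ` carrier ?Q"
        using \<psi>_proj[OF f(1)] proj.hom_closed[OF f(1)] by (metis image_eqI)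
    qed
  qed auto
  have \<psi>_chi: "\<psi> (chi G A) = coset_sums (basis_elem A)" if "A \<in> carrier (subset_monoid G)" for A
    unfolding chi_def by (rule \<psi>_proj[OF basis_elem_closed[OF that]])
  let ?gens = "{chi G (coset_closure A) \<ominus>\<^bsub>?Q\<^esub> chi G A | A. A \<in> carrier (subset_monoid G)}"
  have gens_closed: "?gens \<subseteq> carrier ?Q"
    by (auto simp: chi_closed coset_closure_closed)
  have ideal: "ideal (coset_ideal G) ?Q"
    unfolding coset_ideal_eq by (rule Q.genideal_ideal[OF gens_closed])
  have ker_le: "?ker \<subseteq> coset_ideal G"
  proof
    fix x assume x: "x \<in> ?ker"
    then have xker: "x \<in> carrier ?Q" "\<psi> x = \<zero>\<^bsub>?P\<^esub>"
      unfolding ker_iff by auto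
    obtain f where f: "f \<in> carrier ?R" and xf: "x = zero_line G +>\<^bsub>?R\<^esub> f"
      using FactRing_carrierE[OF xker(1)[unfolded char_algebra_def]] .
    \<comment> \<open>The ideal is pulled back to the monoid algebra, where elements have actual
      coefficients and the triangular argument applies.\<close>
    define N where "N = {f \<in> carrier ?R. zero_line G +>\<^bsub>?R\<^esub> f \<in> coset_ideal G}"
    interpret C: ideal "coset_ideal G" ?Q by (rule ideal)
    have "coset_sums f = \<zero>\<^bsub>?P\<^esub>"
      using xker(2) unfolding xf \<psi>_proj[OF f] .
    then have zero: "coset_sum H f = (\<lambda>C. 0)" if "H \<in> proper_subgroups G" for H
      using that by (auto simp: coset_sums_def product_ring_simps quotient_group_algebra_def
          monoid_algebra_simps dest: fun_cong[of _ _ H])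
    have "f \<in> N"
    proof (rule coset_sums_zero_imp_mem[OF _ _ _ f zero])
      show "ideal N ?R"
        unfolding N_def by (rule proj.ring.ideal_vimage[OF ideal])
      show "zero_line G \<subseteq> N"
      proof
        fix g assume g: "g \<in> zero_line G"
        then have "zero_line G +>\<^bsub>?R\<^esub> g = \<zero>\<^bsub>?Q\<^esub>"
          unfolding char_algebra_def FactRing_def using Z.a_rcos_const[OF g] by simp
        then show "g \<in> N"
          unfolding N_def using Z.a_Hcarr[OF g] C.zero_closed by simp
      qed
      fix A assume A: "A \<in> carrier (subset_monoid G)"
      note closed = basis_elem_closed[OF A, where 'k = rat]
        basis_elem_closed[OF coset_closure_closed[OF A], where 'k = rat]
      have "chi G (coset_closure A) \<ominus>\<^bsub>?Q\<^esub> chi G A \<in> coset_ideal G"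
        unfolding coset_ideal_eq using A by (intro subsetD[OF Q.genideal_self[OF gens_closed]]) blast
      then have "basis_elem (coset_closure A) \<ominus>\<^bsub>?R\<^esub> basis_elem A \<in> N"
        using closed by (simp add: N_def chi_def Q.minus_eq R.minus_eq)
      then show "(\<lambda>B. basis_elem (coset_closure A) B - basis_elem A B) \<in> N"
        by (simp add: S.monoid_algebra_minus[OF finite_subset_monoid closed(2,1)])
    qed
    then show "x \<in> coset_ideal G"
      by (simp add: N_def xf)
  qed
  have coset_ideal_le: "coset_ideal G \<subseteq> ?J"
  proof -
    have gens: "?gens \<subseteq> ?J"
      using Q.nilpotent_imp_jacobson_radical chi_coset_diff_nilpotent gens_closed
      by (smt (verit, ccfv_threshold) mem_Collect_eq subset_iff)
    \<comment> \<open>The radical is not yet known to be an ideal, so the inclusion is checked in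
      one maximal ideal at a time.\<close>
    have "coset_ideal G \<subseteq> M" if M: "maximalideal M ?Q" for M
    proof -
      have "?gens \<subseteq> M"
        using gens M unfolding jacobson_radical_def by blast
      then show ?thesis
        unfolding coset_ideal_eq
        by (rule Q.genideal_minimal[OF maximalideal.axioms(1)[OF M]])
    qed
    moreover have "coset_ideal G \<subseteq> carrier ?Q"
      using ideal by (rule ideal.Icarr[THEN subsetI])
    ultimately show ?thesis
      unfolding jacobson_radical_def by blast
  qed
  have J_le: "?J \<subseteq> ?ker"
  proof
    fix x assume x: "x \<in> ?J"
    then have xc: "x \<in> carrier ?Q"
      unfolding jacobson_radical_def by (rule IntD1)
    obtain n :: nat where n: "x [^]\<^bsub>?Q\<^esub> n = \<zero>\<^bsub>?Q\<^esub>"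
      using S.monoid_algebra_quotient_jacobson_nilpotent[OF finite_subset_monoid zero_line_ideal
          x[unfolded char_algebra_def]] unfolding char_algebra_def by blast
    \<comment> \<open>The components of a nilpotent element are nilpotent, hence zero in the reduced
      group algebras.\<close>
    have "\<psi> x H = \<zero>\<^bsub>quotient_group_algebra G H\<^esub>" if H: "H \<in> proper_subgroups G" for H
    proof -
      interpret H: comm_group "G Mod H"
        by (rule FactGroup_comm_group[OF subgroup[OF H]])
      have hom: "(\<lambda>y. \<psi> y H) \<in> ring_hom ?Q (quotient_group_algebra G H)"
        using ring_hom_trans[OF \<psi> product_ring_proj_hom[OF H]] by (simp add: comp_def)
      interpret h: ring_hom_cring ?Q "quotient_group_algebra G H" "\<lambda>y. \<psi> y H"
        by (intro ring_hom_cring.intro ring_hom_cring_axioms.intro Q.is_cring hom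
            quotient_group_algebra_cring subgroup H)
      have "\<psi> x H [^]\<^bsub>quotient_group_algebra G H\<^esub> n = \<zero>\<^bsub>quotient_group_algebra G H\<^esub>"
        using h.ring.hom_nat_pow[OF xc, of n] n H by (simp add: product_ring_simps)
      then show ?thesis
        using h.hom_closed[OF xc] H.group_algebra_reduced[OF finite_FactGroup[OF subgroup[OF H]]]
        unfolding quotient_group_algebra_def by blast
    qed
    then have "\<psi> x = \<zero>\<^bsub>?P\<^esub>"
      by (intro product_ring_eqI[OF \<psi>.hom_closed[OF xc]]) (simp_all add: product_ring_simps)
    then show "x \<in> ?ker"
      using xc unfolding ker_iff by simp
  qed
  \<comment> \<open>The three inclusions close a cycle from the kernel through the coset ideal and
    the radical back to the kernel.\<close>
  have J: "?J = coset_ideal G" "?J = ?ker"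
    using ker_le coset_ideal_le J_le by auto
  let ?iso = "\<lambda>Y. the_elem (\<psi> ` Y)"
  have iso: "?iso \<in> ring_iso (?Q Quot ?J) ?P"
    unfolding J(2) by (rule \<psi>.ring.FactRing_iso_set[OF surj])
  \<comment> \<open>Taking the inverse of the isomorphism induced by \<open>\<psi>\<close> reduces
    the claim about unit elements to evaluating \<open>\<psi>\<close> on the products.\<close>
  define \<phi> where "\<phi> = inv_into (carrier (?Q Quot ?J)) ?iso"
  have \<phi>: "\<phi> \<in> ring_iso ?P (?Q Quot ?J)"
    unfolding \<phi>_def
    using ring_iso_set_sym[OF ideal.quotient_is_ring[OF ideal, folded J(1)] iso] .
  have "\<phi> (summand_inj (proper_subgroups G) (quotient_group_algebra G) H
        \<one>\<^bsub>quotient_group_algebra G H\<^esub>) =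
      ?J +>\<^bsub>?Q\<^esub> (\<Otimes>\<^bsub>?Q\<^esub>K \<in> min_nontrivial_subgroups (G Mod H).
        chi G H \<ominus>\<^bsub>?Q\<^esub> chi G (quotient_preimage G H K))"
    if H: "H \<in> proper_subgroups G" for H
  proof -
    let ?M = "min_nontrivial_subgroups (G Mod H)"
    let ?factor = "\<lambda>K. chi G H \<ominus>\<^bsub>?Q\<^esub> chi G (quotient_preimage G H K)"
    note H' = subgroup[OF H]
    note pre = quotient_preimage_min_nontrivial[OF H']
    have finM: "finite ?M"
      using finite_FactGroup[OF H'] by (auto simp: min_nontrivial_subgroups_def
          intro!: finite_subset[of _ "Pow (carrier (G Mod H))"] dest: subgroup.subset)
    have factor_closed: "?factor \<in> ?M \<rightarrow> carrier ?Q"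
      using H' pre(1) by (auto intro!: Q.minus_closed chi_closed subgroup_in_subset_monoid)
    have prod_closed: "finprod ?Q ?factor ?M \<in> carrier ?Q"
      by (rule Q.finprod_closed[OF factor_closed])
    have "\<psi> (finprod ?Q ?factor ?M) L =
        (if L = H then \<one>\<^bsub>quotient_group_algebra G L\<^esub> else \<zero>\<^bsub>quotient_group_algebra G L\<^esub>)"
      if L: "L \<in> proper_subgroups G" for L
    proof -
      note L' = subgroup[OF L]
      let ?A = "quotient_group_algebra G L"
      have hom: "(\<lambda>y. \<psi> y L) \<in> ring_hom ?Q ?A"
        using ring_hom_trans[OF \<psi> product_ring_proj_hom[OF L]] by (simp add: comp_def)
      interpret h: ring_hom_cring ?Q ?A "\<lambda>y. \<psi> y L"
        by (intro ring_hom_cring.intro ring_hom_cring_axioms.intro Q.is_cring hom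
            quotient_group_algebra_cring L')
      have chi: "\<psi> (chi G K) L = (if K \<subseteq> L then \<one>\<^bsub>?A\<^esub> else \<zero>\<^bsub>?A\<^esub>)" if "subgroup K G" for K
        using that L by (simp add: \<psi>_chi subgroup_in_subset_monoid coset_sums_def coset_sum_subgroup L')
      \<comment> \<open>Each factor becomes a difference of two indicator values: it vanishes when
        \<open>L\<close> contains both subgroups or neither, and is the identity when
        \<open>L\<close> contains \<open>H\<close> only.\<close>
      have factor: "\<psi> (?factor K) L = (if H \<subseteq> L then \<one>\<^bsub>?A\<^esub> else \<zero>\<^bsub>?A\<^esub>) \<ominus>\<^bsub>?A\<^esub>
          (if quotient_preimage G H K \<subseteq> L then \<one>\<^bsub>?A\<^esub> else \<zero>\<^bsub>?A\<^esub>)" if "K \<in> ?M" for K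
      proof -
        note closed = H'[THEN subgroup_in_subset_monoid, THEN chi_closed]
          pre(1)[OF that, THEN subgroup_in_subset_monoid, THEN chi_closed]
        show ?thesis
          unfolding Q.minus_eq h.S.minus_eq h.hom_add[OF closed(1) Q.a_inv_closed[OF closed(2)]]
            h.hom_a_inv[OF closed(2)] chi[OF H'] chi[OF pre(1)[OF that]] ..
      qed
      have prod: "\<psi> (finprod ?Q ?factor ?M) L = finprod ?A (\<lambda>K. \<psi> (?factor K) L) ?M"
        using h.hom_finprod[OF factor_closed] by (simp add: comp_def)
      have image_closed: "(\<lambda>K. \<psi> (?factor K) L) \<in> ?M \<rightarrow> carrier ?A"
        using factor_closed h.hom_closed by (auto simp: Pi_iff)
      consider "L = H" | "H \<subset> L" | "\<not> H \<subseteq> L" by blast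
      then show ?thesis
      proof cases
        case 1
        have "\<psi> (?factor K) L = \<one>\<^bsub>?A\<^esub>" if "K \<in> ?M" for K
        proof -
          have "H \<subseteq> L" "\<not> quotient_preimage G H K \<subseteq> L"
            using pre(2)[OF that] 1 by blast+
          then show ?thesis
            using factor[OF that] by (simp add: h.S.minus_eq)
        qed
        then show ?thesis
          unfolding prod using 1 h.S.finprod_one_eqI[of ?M "\<lambda>K. \<psi> (?factor K) L"] by simp
      next
        case 2
        then obtain K where K: "K \<in> ?M" "quotient_preimage G H K \<subseteq> L"
          using exists_min_nontrivial_preimage_below[OF H' L'] by blast
        then have "\<psi> (?factor K) L = \<zero>\<^bsub>?A\<^esub>"
          using factor[OF K(1)] 2 by (simp add: h.S.minus_eq h.S.r_neg psubset_imp_subset)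
        then show ?thesis
          unfolding prod using 2 h.S.finprod_zeroI[OF finM image_closed K(1)] by auto
      next
        case 3
        \<comment> \<open>Every factor vanishes in this case, but an empty product would be the
          identity; that \<open>H\<close> is proper guarantees at least one factor.\<close>
        have "H \<subset> carrier G"
          using H subgroup.subset[OF H'] by (auto simp: proper_subgroups_def)
        then obtain K where K: "K \<in> ?M"
          using exists_min_nontrivial_preimage_below[OF H' subgroup_self] by blast
        have "\<not> quotient_preimage G H K \<subseteq> L"
          using pre(2)[OF K] 3 by blast
        then have "\<psi> (?factor K) L = \<zero>\<^bsub>?A\<^esub>"
          using factor[OF K(1)] 3 by (simp add: h.S.minus_eq)
        then show ?thesis
          unfolding prod using 3 h.S.finprod_zeroI[OF finM image_closed K(1)] by auto
      qed
    qed
    then have "\<psi> (finprod ?Q ?factor ?M) = summand_inj (proper_subgroups G)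
        (quotient_group_algebra G) H \<one>\<^bsub>quotient_group_algebra G H\<^esub>"
      by (intro product_ring_eqI[OF \<psi>.hom_closed[OF prod_closed]]) (auto simp: summand_inj_def)
    then have "?iso (?J +>\<^bsub>?Q\<^esub> finprod ?Q ?factor ?M) = summand_inj (proper_subgroups G)
        (quotient_group_algebra G) H \<one>\<^bsub>quotient_group_algebra G H\<^esub>"
      unfolding J(2) using \<psi>.ring.the_elem_simp[OF prod_closed] by simp
    moreover have "?J +>\<^bsub>?Q\<^esub> finprod ?Q ?factor ?M \<in> carrier (?Q Quot ?J)"
      using prod_closed by (auto simp: FactRing_def A_RCOSETS_def')
    ultimately show ?thesis
      unfolding \<phi>_def using iso by (intro inv_into_f_eq) (auto simp: ring_iso_def bij_betw_def)
  qed
  then show ?thesis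
    using J(1) \<phi> by blast
qed

end
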